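(* Let $I=[0,1]$ and $T>0$, and assume that $\mathbf a$, $\mathbf s$, $x^0$, $m^0$ satisfy the following hypotheses. (H1) $\mathbf a:\mathbb R\to\mathbb R$ is Lipschitz with $\mathrm{Lip}(\mathbf a)=L$, and $\mathbf a(0)=0$. (H2) $m^0\in L^\infty(I)$, $\int_I m^0(s)\,ds=1$, and $\frac1M\le m^0\le M$ for some $M>1$; $x^0\in C(I)$ is a real-valued one-to-one function with $|x^0|\le X$ for some $X>0$. (H3) $\mathbf s:\mathbb R\to\mathbb R$ is odd, there is $\mathbf S_\infty>0$ with $|\mathbf s(x)|\le \mathbf S_\infty$ for all $x\in\mathbb R$, and there is $\mathbf S>0$ such that $|\mathbf s(x_1)-\mathbf s(x_2)|\le \mathbf S|x_1-x_2|$ whenever $x_1,x_2\in(0,\infty)$ and whenever $x_1,x_2\in(-\infty,0)$. Then there exists a unique solution $(x,m)\in C^1([0,T];C(I))\oplus C^1([0,T];L^\infty(I))$ of the system $$\left\{\begin{array}{ll}\partial_t x(t,s)=\int_I m(t,s_\ast)\,\mathbf a(x(t,s_\ast)-x(t,s))\,ds_\ast, & x(0,s)=x^0(s),\\ \partial_t m(t,s)=\Psi(s,x(t,\cdot),m(t,\cdot)), & m(0,s)=m^0(s).\end{array}\right.$$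
   Context: For functions $x,m$ on $I=[0,1]$ and $s\in I$, the functional $\Psi$ is defined by $$\Psi(s,x(\cdot),m(\cdot)):=m(s)\iint_{I^2}m(s_\ast)m(s_{\ast\ast})\big(\mathbf a(x(s_{\ast\ast})-x(s))+\mathbf a(x(s_{\ast\ast})-x(s_\ast))\big)\,\mathbf s(x(s)-x(s_\ast))\,ds_\ast\,ds_{\ast\ast}.$$ *)

theory Defs
  imports "HOL-Probability.Essential_Supremum"
begin

abbreviation I01 :: "real set" where
  "I01 \<equiv> {0..1}"

abbreviation leb_I :: "real measure" where
  "leb_I \<equiv> lebesgue_on I01"

text \<open>Elements of \<open>C(I)\<close> and of \<open>L\<^sup>\<infinity>(I)\<close> are represented by functions \<open>real \<Rightarrow> real\<close>; only
  their values on \<open>I\<close> (respectively, almost everywhere on \<open>I\<close>) are relevant, so equality in these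
  spaces is equality on \<open>I\<close> (respectively, a.e. equality). The norms are extended real.\<close>

definition C_I :: "(real \<Rightarrow> real) set" where
  "C_I = {f. continuous_on I01 f}"

definition C_norm :: "(real \<Rightarrow> real) \<Rightarrow> ereal" where
  "C_norm f = (SUP s\<in>I01. ereal \<bar>f s\<bar>)"

text \<open>\<open>esssup\<close> returns \<open>\<infinity>\<close> on functions that are not measurable, but \<open>\<bar>f\<bar>\<close> can be measurable
  without \<open>f\<close> being so; hence the measurability condition in \<open>Linf_I\<close>.\<close>

definition Linf_norm :: "(real \<Rightarrow> real) \<Rightarrow> ereal" where
  "Linf_norm f = esssup leb_I (\<lambda>s. ereal \<bar>f s\<bar>)"

definition Linf_I :: "(real \<Rightarrow> real) set" where
  "Linf_I = {f \<in> borel_measurable leb_I. Linf_norm f < \<infinity>}"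

text \<open>The curve \<open>u\<close> on \<open>[0,T]\<close> has derivative \<open>v\<close> at \<open>t\<close> with respect to the norm \<open>N\<close>
  (one-sided at the endpoints).\<close>

definition has_time_deriv ::
  "((real \<Rightarrow> real) \<Rightarrow> ereal) \<Rightarrow> real \<Rightarrow> (real \<Rightarrow> real \<Rightarrow> real) \<Rightarrow> (real \<Rightarrow> real) \<Rightarrow> real \<Rightarrow> bool" where
  "has_time_deriv N T u v t \<longleftrightarrow>
     ((\<lambda>r. N (\<lambda>s. (u r s - u t s) / (r - t) - v s)) \<longlongrightarrow> 0) (at t within {0..T})"

definition continuous_curve ::
  "((real \<Rightarrow> real) \<Rightarrow> ereal) \<Rightarrow> real \<Rightarrow> (real \<Rightarrow> real \<Rightarrow> real) \<Rightarrow> bool" where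
  "continuous_curve N T v \<longleftrightarrow>
     (\<forall>t\<in>{0..T}. ((\<lambda>r. N (\<lambda>s. v r s - v t s)) \<longlongrightarrow> 0) (at t within {0..T}))"

text \<open>\<open>C\<^sup>1([0,T]; E)\<close> for the space \<open>E\<close> normed by \<open>N\<close>.\<close>

definition C1_curves ::
  "(real \<Rightarrow> real) set \<Rightarrow> ((real \<Rightarrow> real) \<Rightarrow> ereal) \<Rightarrow> real \<Rightarrow> (real \<Rightarrow> real \<Rightarrow> real) set" where
  "C1_curves E N T = {u. (\<forall>t\<in>{0..T}. u t \<in> E) \<and>
     (\<exists>v. (\<forall>t\<in>{0..T}. v t \<in> E \<and> has_time_deriv N T u (v t) t) \<and> continuous_curve N T v)}"

text \<open>\<open>s1\<close> and \<open>s2\<close> are \<open>s\<^sub>*\<close> and \<open>s\<^sub>*\<^sub>*\<close>; \<open>\<sigma>\<close> is the function written in bold s.\<close>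

definition Psi ::
  "(real \<Rightarrow> real) \<Rightarrow> (real \<Rightarrow> real) \<Rightarrow> real \<Rightarrow> (real \<Rightarrow> real) \<Rightarrow> (real \<Rightarrow> real) \<Rightarrow> real" where
  "Psi a \<sigma> s x m = m s *
     (\<integral>(s1, s2). m s1 * m s2 * (a (x s2 - x s) + a (x s2 - x s1)) * \<sigma> (x s - x s1)
        \<partial>(leb_I \<Otimes>\<^sub>M leb_I))"

definition solves_system ::
  "(real \<Rightarrow> real) \<Rightarrow> (real \<Rightarrow> real) \<Rightarrow> (real \<Rightarrow> real) \<Rightarrow> (real \<Rightarrow> real) \<Rightarrow> real \<Rightarrow>
   (real \<Rightarrow> real \<Rightarrow> real) \<Rightarrow> (real \<Rightarrow> real \<Rightarrow> real) \<Rightarrow> bool" where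
  "solves_system a \<sigma> x0 m0 T x m \<longleftrightarrow>
     x \<in> C1_curves C_I C_norm T \<and>
     m \<in> C1_curves Linf_I Linf_norm T \<and>
     (\<forall>t\<in>{0..T}. has_time_deriv C_norm T x
        (\<lambda>s. \<integral>s1. m t s1 * a (x t s1 - x t s) \<partial>leb_I) t) \<and>
     (\<forall>t\<in>{0..T}. has_time_deriv Linf_norm T m (\<lambda>s. Psi a \<sigma> s (x t) (m t)) t) \<and>
     (\<forall>s\<in>I01. x 0 s = x0 s) \<and>
     (AE s in leb_I. m 0 s = m0 s)"

text \<open>The best Lipschitz constant (meaningful for Lipschitz \<open>f\<close> only).\<close>

definition Lip :: "(real \<Rightarrow> real) \<Rightarrow> real" where
  "Lip f = Inf {C. C-lipschitz_on UNIV f}"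

end

theory Submission
  imports Defs "HOL-Probability.Probability_Measure" "HOL-Probability.Discrete_Topology"
begin

text \<open>Differences \<open>w = x(t,s) - x(t,s')\<close> satisfy \<open>\<bar>w'\<bar> \<le> K * \<bar>w\<bar>\<close>, so the order of the opinions is the
  initial one at all times. Writing \<open>\<sigma> z = c * sgn z + \<rho> z\<close> with \<open>\<rho>\<close> Lipschitz, the jump term
  \<open>sgn (x(t,s) - x(t,s'))\<close> is therefore constant in time, and once it is frozen the system is an ordinary
  differential equation with a locally Lipschitz right-hand side in the space of bounded functions.
  For existence the unknowns are clipped to a box. The solution of the clipped system keeps \<open>m\<close>
  positive and, because the kernel stays antisymmetric, keeps its total mass equal to \<open>1\<close>; hence \<open>x\<close>
  grows at most exponentially at a rate independent of the box, then so does \<open>m\<close> at a rate that depends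
  only on the bound for \<open>x\<close>, and a suitable box is never left. Uniqueness follows from a Gronwall argument in the
  \<open>C(I)\<close> and \<open>L\<^sup>\<infinity>(I)\<close> distances, where positivity and mass conservation play no role.\<close>

subsection \<open>Differential inequalities\<close>

text \<open>The obstacle is the jump of \<open>\<sigma>\<close> at 0: a small perturbation in the
  sup norm can reverse the sign of \<open>x s - x s1\<close>, so \<open>Psi\<close> is in general
  not Lipschitz in \<open>x\<close>. Freezing the sign is not circular, because the equation for
  \<open>x\<close> does not contain \<open>\<sigma>\<close>: the order of any solution, constructed
  or given, is controlled before \<open>Psi\<close> is examined, and all solutions then solve one
  and the same frozen system. Two properties are therefore handled separately. Measurability in
  \<open>s\<close>, without which the integrals cannot be estimated, is kept by working in a closed
  subspace. Continuity of \<open>x t\<close> in \<open>s\<close> is recovered afterwards: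
  differences of \<open>x t\<close> are at most a constant times those of the initial state.
  Clipping is needed because \<open>m * G\<close> is only locally Lipschitz. The box is found
  without circularity since the rate for \<open>x\<close> uses only mass 1, not the bound on
  \<open>m\<close>.\<close>

lemma sgn_preserved:
  fixes w w' :: "real \<Rightarrow> real"
  assumes T: "0 \<le> T" and t: "t \<in> {0..T}"
    and der: "\<And>t. t \<in> {0..T} \<Longrightarrow> (w has_real_derivative w' t) (at t within {0..T})"
    and bd: "\<And>t. t \<in> {0..T} \<Longrightarrow> \<bar>w' t\<bar> \<le> K * \<bar>w t\<bar>"
  shows "sgn (w t) = sgn (w 0)" and "\<bar>w t\<bar> \<le> \<bar>w 0\<bar> * exp (K * t)"
proof -
  \<comment> \<open>Squaring removes the absolute values: the derivative \<open>2 * w * w'\<close>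
    of the square lies between \<open>- 2 * K\<close> and \<open>2 * K\<close> times the square. The
    lower bound excludes zeros of \<open>w\<close>, the upper one gives the growth estimate.\<close>
  have main: "(w 0)\<^sup>2 * exp (- (2 * K * t)) \<le> (w t)\<^sup>2 \<and> (w t)\<^sup>2 \<le> (w 0)\<^sup>2 * exp (2 * K * t)"
    if t: "t \<in> {0..T}" for t
  proof -
    \<comment> \<open>The rate \<open>k\<close> is left free: \<open>2 * K\<close> makes the
      weighted square increase, \<open>- (2 * K)\<close> makes it decrease.\<close>
    have der2: "((\<lambda>r. (w r)\<^sup>2 * exp (k * r)) has_real_derivative
        (2 * w r * w' r + k * (w r)\<^sup>2) * exp (k * r)) (at r within {0..t})" if "r \<in> {0..t}" for r k
      by (rule derivative_eq_intros DERIV_subset[OF der] refl | use that t in \<open>force simp: algebra_simps\<close>)+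
    have cont: "continuous_on {0..t} (\<lambda>r. (w r)\<^sup>2 * exp (k * r))" for k
      by (rule DERIV_continuous_on[OF der2])
    have der3: "DERIV (\<lambda>r. (w r)\<^sup>2 * exp (k * r)) r :> (2 * w r * w' r + k * (w r)\<^sup>2) * exp (k * r)"
      if "0 < r" "r < t" for r k
      using der2[of r k] at_within_Icc_at[of 0 r t] that by auto
    have ww: "\<bar>2 * w r * w' r\<bar> \<le> 2 * K * (w r)\<^sup>2" if "0 < r" "r < t" for r
    proof -
      have "\<bar>2 * w r * w' r\<bar> = 2 * \<bar>w r\<bar> * \<bar>w' r\<bar>" by (simp add: abs_mult)
      also have "\<dots> \<le> 2 * \<bar>w r\<bar> * (K * \<bar>w r\<bar>)"
        using that t by (intro mult_left_mono bd) auto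
      also have "\<dots> = 2 * K * (w r)\<^sup>2" by (simp add: power2_eq_square)
      finally show ?thesis .
    qed
    have "(w 0)\<^sup>2 * exp (2 * K * 0) \<le> (w t)\<^sup>2 * exp (2 * K * t)"
    proof (rule DERIV_nonneg_imp_increasing_open[OF _ _ cont])
      fix r assume r: "0 < r" "r < t"
      show "\<exists>y. DERIV (\<lambda>r. (w r)\<^sup>2 * exp (2 * K * r)) r :> y \<and> y \<ge> 0"
        using der3[OF r, of "2 * K"] ww[OF r]
        by (intro exI[of _ "(2 * w r * w' r + 2 * K * (w r)\<^sup>2) * exp (2 * K * r)"] conjI mult_nonneg_nonneg) auto
    qed (use t in auto)
    moreover have "(w t)\<^sup>2 * exp (- (2 * K) * t) \<le> (w 0)\<^sup>2 * exp (- (2 * K) * 0)"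
    proof (rule DERIV_nonpos_imp_decreasing_open[OF _ _ cont])
      fix r assume r: "0 < r" "r < t"
      show "\<exists>y. DERIV (\<lambda>r. (w r)\<^sup>2 * exp (- (2 * K) * r)) r :> y \<and> y \<le> 0"
        using der3[OF r, of "- (2 * K)"] ww[OF r]
        by (intro exI[of _ "(2 * w r * w' r + - (2 * K) * (w r)\<^sup>2) * exp (- (2 * K) * r)"] conjI mult_nonpos_nonneg) auto
    qed (use t in auto)
    ultimately show ?thesis
      by (auto simp: exp_minus field_simps)
  qed
  have "\<bar>w t\<bar>\<^sup>2 \<le> (\<bar>w 0\<bar> * exp (K * t))\<^sup>2"
    using main[OF t] by (simp add: power_mult_distrib mult.assoc flip: exp_double)
  then show "\<bar>w t\<bar> \<le> \<bar>w 0\<bar> * exp (K * t)"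
    by (rule power2_le_imp_le) auto
  have cw: "continuous_on {0..t} w"
    using DERIV_continuous_on[OF der] t by (auto intro: continuous_on_subset)
  \<comment> \<open>Without zeros on the way, the intermediate value theorem rules out a change of
    sign.\<close>
  have nz: "w r \<noteq> 0" if "r \<in> {0..t}" "w 0 \<noteq> 0" for r
  proof -
    have "0 < (w 0)\<^sup>2 * exp (- (2 * K * r))" using that by simp
    also have "\<dots> \<le> (w r)\<^sup>2" using main[of r] that t by simp
    finally show ?thesis by auto
  qed
  have t0: "0 \<le> t" using t by simp
  consider "w 0 = 0" | "w 0 > 0" | "w 0 < 0" by linarith
  then show "sgn (w t) = sgn (w 0)"
  proof cases
    case 1
    then show ?thesis using main[OF t] by simp
  next
    case 2
    have "w t > 0"
    proof (rule ccontr)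
      assume "\<not> w t > 0"
      then obtain r where "0 \<le> r" "r \<le> t" "w r = 0"
        using IVT2'[of w t 0 0, OF _ _ t0 cw] 2 by auto
      then show False using nz[of r] 2 by auto
    qed
    then show ?thesis using 2 by simp
  next
    case 3
    have "w t < 0"
    proof (rule ccontr)
      assume "\<not> w t < 0"
      then obtain r where "0 \<le> r" "r \<le> t" "w r = 0"
        using IVT'[of w 0 0 t, OF _ _ t0 cw] 3 by auto
      then show False using nz[of r] 3 by auto
    qed
    then show ?thesis using 3 by simp
  qed
qed

text \<open>Only a one-sided inequality for increments is required, because the lemma is applied to
  norms and to an infimum of bounds, which need not be differentiable. The function is compared with
  the strict supersolution \<open>(A + \<delta>) * exp ((K + \<delta>) * t)\<close>, and
  \<open>\<delta>\<close> then tends to 0.\<close>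

lemma dini_gronwall:
  fixes f :: "real \<Rightarrow> real"
  assumes t: "t \<in> {0..T}" and K: "0 \<le> K" and A: "0 \<le> A" "f 0 \<le> A"
    and cont: "continuous_on {0..T} f"
    and step: "\<And>t e. t \<in> {0..<T} \<Longrightarrow> e > 0 \<Longrightarrow>
      \<exists>d>0. \<forall>r\<in>{t<..T}. r < t + d \<longrightarrow> f r \<le> f t + (r - t) * (K * f t + e)"
  shows "f t \<le> A * exp (K * t)"
proof -
  have claim: "f t \<le> (A + \<delta>) * exp ((K + \<delta>) * t)" if \<delta>: "\<delta> > 0" for \<delta>
  proof (rule ccontr)
    define b where "b r = (A + \<delta>) * exp ((K + \<delta>) * r)" for r
    define g where "g r = f r - b r" for r
    assume "\<not> ?thesis"
    then have gt: "g t > 0" by (simp add: g_def b_def)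
    \<comment> \<open>The supremum of \<open>Z\<close> is the last time before \<open>t\<close> at
      which \<open>f\<close> has not passed the barrier \<open>b\<close>; by continuity
      \<open>f\<close> and \<open>b\<close> agree there.\<close>
    define Z where "Z = {r \<in> {0..t}. g r \<le> 0}"
    have contg: "continuous_on {0..t} g"
      unfolding g_def b_def using t
      by (intro continuous_intros continuous_on_subset[OF cont]) auto
    have "closed Z"
      unfolding Z_def by (intro continuous_on_closed_Collect_le contg continuous_intros closed_atLeastAtMost)
    moreover have Z0: "0 \<in> Z"
      using t A \<delta> by (auto simp: Z_def g_def b_def)
    moreover have bdd: "bdd_above Z"
      by (auto simp: Z_def intro: bdd_aboveI[of _ t])
    ultimately have "Sup Z \<in> Z"
      by (intro closed_contains_Sup) auto
    define z where "z = Sup Z"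
    have z: "0 \<le> z" "z \<le> t" "g z \<le> 0"
      using \<open>Sup Z \<in> Z\<close> by (auto simp: z_def Z_def)
    with gt have "z < t" by (cases "z = t") auto
    have after: "g r > 0" if "z < r" "r \<le> t" for r
    proof (rule ccontr)
      assume "\<not> g r > 0"
      then have "r \<in> Z" using that z by (auto simp: Z_def)
      then have "r \<le> z" unfolding z_def using bdd by (rule cSup_upper)
      then show False using that by simp
    qed
    have "g z = 0"
    proof (rule ccontr)
      assume "g z \<noteq> 0"
      then obtain r where "z \<le> r" "r \<le> t" "g r = 0"
        using IVT'[of g z 0 t] z gt \<open>z < t\<close> continuous_on_subset[OF contg, of "{z..t}"] by auto
      moreover have "r \<noteq> z" using \<open>g z \<noteq> 0\<close> \<open>g r = 0\<close> by auto
      ultimately show False using after[of r] by auto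
    qed
    then have fz: "f z = b z" by (simp add: g_def)
    have bz: "b z > 0" using A \<delta> by (simp add: b_def)
    \<comment> \<open>The error \<open>\<delta> * b z\<close> is exactly the surplus in the growth
      rate of \<open>b\<close>, so \<open>f\<close> stays below the barrier just after
      \<open>z\<close>, contrary to the choice of \<open>z\<close>.\<close>
    obtain d where d: "d > 0" "\<And>r. r \<in> {z<..T} \<Longrightarrow> r < z + d \<Longrightarrow>
        f r \<le> f z + (r - z) * (K * f z + \<delta> * b z)"
      using step[of z "\<delta> * b z"] z \<open>z < t\<close> t bz \<delta> by auto
    define r where "r = min t (z + d / 2)"
    have r: "z < r" "r \<le> t" "r < z + d" "r \<le> T"
      using \<open>z < t\<close> d(1) t by (auto simp: r_def)
    have "f r \<le> f z + (r - z) * (K * f z + \<delta> * b z)"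
      using r by (intro d) auto
    also have "\<dots> = b z * (1 + (K + \<delta>) * (r - z))"
      by (simp add: fz algebra_simps)
    also have "\<dots> \<le> b z * exp ((K + \<delta>) * (r - z))"
      using bz by (intro mult_left_mono exp_ge_add_one_self) auto
    also have "\<dots> = b r"
      by (simp add: b_def algebra_simps flip: exp_add)
    finally show False using after[OF r(1,2)] by (simp add: g_def)
  qed
  have "((\<lambda>\<delta>. (A + \<delta>) * exp ((K + \<delta>) * t)) \<longlongrightarrow> (A + 0) * exp ((K + 0) * t)) (at_right 0)"
    by (intro tendsto_intros)
  moreover have "\<forall>\<^sub>F \<delta> in at_right 0. f t \<le> (A + \<delta>) * exp ((K + \<delta>) * t)"
    using claim by (auto simp: eventually_at_filter)
  ultimately show ?thesis
    using tendsto_lowerbound[of _ _ "at_right (0::real)" "f t"] by simp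
qed

text \<open>\<open>P t c\<close> stands for \<open>D t \<le> c\<close>, where \<open>D\<close> is a distance that is only available through its upper
  bounds.\<close>

lemma dini_gronwall_bounds:
  fixes P :: "real \<Rightarrow> real \<Rightarrow> bool"
  assumes t: "t \<in> {0..T}" and K: "0 \<le> K" and c: "c > 0"
    and mono: "\<And>t c c'. P t c \<Longrightarrow> c \<le> c' \<Longrightarrow> P t c'" and nonneg: "\<And>t c. P t c \<Longrightarrow> 0 \<le> c"
    and ex: "\<And>t. t \<in> {0..T} \<Longrightarrow> \<exists>c. P t c" and init: "P 0 0"
    and cont: "\<And>t e. t \<in> {0..T} \<Longrightarrow> e > 0 \<Longrightarrow> \<exists>d>0. \<forall>r\<in>{0..T}. \<bar>r - t\<bar> < d \<longrightarrow>
      (\<forall>c. (P t c \<longrightarrow> P r (c + e)) \<and> (P r c \<longrightarrow> P t (c + e)))"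
    and step: "\<And>t e. t \<in> {0..<T} \<Longrightarrow> e > 0 \<Longrightarrow> \<exists>d>0. \<forall>r\<in>{t<..T}. r < t + d \<longrightarrow>
      (\<forall>c. P t c \<longrightarrow> P r (c + (r - t) * (K * c + e)))"
  shows "P t c"
proof -
  define D where "D t = Inf {c. P t c}" for t
  have bdd: "bdd_below {c. P t c}" for t using nonneg by (intro bdd_belowI[of _ 0]) auto
  have D_le: "D t \<le> c" if "P t c" for t c
    unfolding D_def using that bdd by (intro cInf_lower) auto
  have D_less: "P t c" if t: "t \<in> {0..T}" and less: "D t < c" for t c
  proof -
    have "{c. P t c} \<noteq> {}" using ex[OF t] by blast
    then obtain c' where "P t c'" "c' < c"
      using cInf_lessD[of "{c. P t c}" c] less unfolding D_def by blast
    then show ?thesis using mono[of t c' c] by simp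
  qed
  \<comment> \<open>The infimum \<open>D t\<close> need not itself be an admissible bound. Estimates
    pass to it by letting the bounds \<open>c\<close> decrease to \<open>D t\<close> in a continuous
    \<open>f\<close>.\<close>
  have D_bound: "D r \<le> f (D t)" if t: "t \<in> {0..T}" and f: "\<And>c. P t c \<Longrightarrow> P r (f c)" "isCont f (D t)" for t r f
  proof -
    have "(f \<longlongrightarrow> f (D t)) (at_right (D t))"
      using f(2) unfolding isCont_def by (rule tendsto_within_subset) simp
    moreover have "\<forall>\<^sub>F c in at_right (D t). D r \<le> f c"
      using D_less[OF t] D_le f(1) by (auto simp: eventually_at_filter)
    ultimately show ?thesis by (intro tendsto_lowerbound[of f _ "at_right (D t)"]) auto
  qed
  have "continuous_on {0..T} D"
    unfolding continuous_on_iff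
  proof (intro ballI allI impI)
    fix t e :: real assume t: "t \<in> {0..T}" and e: "e > 0"
    then obtain d where d: "d > 0" "\<And>r c. r \<in> {0..T} \<Longrightarrow> \<bar>r - t\<bar> < d \<Longrightarrow> P t c \<Longrightarrow> P r (c + e / 2)"
      "\<And>r c. r \<in> {0..T} \<Longrightarrow> \<bar>r - t\<bar> < d \<Longrightarrow> P r c \<Longrightarrow> P t (c + e / 2)"
      using cont[of t "e / 2"] by (meson half_gt_zero)
    have "dist (D r) (D t) < e" if r: "r \<in> {0..T}" "dist r t < d" for r
    proof -
      have "D r \<le> D t + e / 2" "D t \<le> D r + e / 2"
        using r t d by (intro D_bound[where f = "\<lambda>c. c + e / 2"] continuous_intros; simp add: dist_real_def)+
      then show ?thesis using e by (simp add: dist_real_def)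
    qed
    then show "\<exists>d>0. \<forall>r\<in>{0..T}. dist r t < d \<longrightarrow> dist (D r) (D t) < e" using d(1) by blast
  qed
  then have "D t \<le> 0 * exp (K * t)"
  proof (rule dini_gronwall[where f = D, OF t K order_refl D_le[OF init]])
    fix t e :: real assume t: "t \<in> {0..<T}" and e: "e > 0"
    obtain d where d: "d > 0" "\<And>r c. r \<in> {t<..T} \<Longrightarrow> r < t + d \<Longrightarrow> P t c \<Longrightarrow> P r (c + (r - t) * (K * c + e))"
      using step[OF t e] by blast
    have "D r \<le> D t + (r - t) * (K * D t + e)" if "r \<in> {t<..T}" "r < t + d" for r
      using t that d by (intro D_bound[where f = "\<lambda>c. c + (r - t) * (K * c + e)"] continuous_intros) auto
    then show "\<exists>d>0. \<forall>r\<in>{t<..T}. r < t + d \<longrightarrow> D r \<le> D t + (r - t) * (K * D t + e)"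
      using d(1) by blast
  qed
  then show ?thesis using D_less[OF t] c by simp
qed

subsection \<open>Differential equations in Banach spaces\<close>

text \<open>Riemann sums are linear combinations of values in \<open>V\<close>, and the integral is
  their limit. This keeps Picard iterates inside the subspace where the vector field is
  controlled.\<close>

lemma integral_in_closed_subspace:
  fixes f :: "real \<Rightarrow> 'a::banach"
  assumes V: "subspace V" "closed V" and f: "f integrable_on {a..b}"
    and fV: "\<And>r. r \<in> {a..b} \<Longrightarrow> f r \<in> V"
  shows "integral {a..b} f \<in> V"
proof -
  have "\<exists>y\<in>V. dist y (integral {a..b} f) < e" if e: "e > 0" for e
  proof -
    have hi: "(f has_integral integral {a..b} f) (cbox a b)"
      using f by (simp add: integrable_integral)
    obtain \<gamma> where \<gamma>: "gauge \<gamma>" "\<And>D. D tagged_division_of cbox a b \<Longrightarrow> \<gamma> fine D \<Longrightarrow>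
        norm ((\<Sum>(x,k)\<in>D. measure lborel k *\<^sub>R f x) - integral {a..b} f) < e"
      by (rule has_integralD[OF hi e], rule that) blast+
    obtain D where D: "D tagged_division_of cbox a b" "\<gamma> fine D"
      using fine_division_exists[OF \<gamma>(1)] by blast
    have "(\<Sum>(x,k)\<in>D. measure lborel k *\<^sub>R f x) \<in> V"
    proof (intro subspace_sum V)
      fix p assume p: "p \<in> D"
      obtain x k where [simp]: "p = (x, k)" by (cases p)
      have "x \<in> {a..b}" using tag_in_interval[OF D(1), of x k] p by simp
      then show "(case p of (x, k) \<Rightarrow> measure lborel k *\<^sub>R f x) \<in> V"
        using fV V(1) by (simp add: subspace_scale)
    qed
    then show ?thesis using \<gamma>(2)[of D] D by (auto simp: dist_norm)
  qed
  then have "integral {a..b} f \<in> closure V" by (simp add: closure_approachable)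
  then show ?thesis using V(2) by simp
qed

text \<open>In the unknown \<open>exp (- (2 * K + 1) * t) *\<^sub>R u t\<close> the Picard operator contracts on the whole of
  \<open>{0..T}\<close>.\<close>

theorem ode_solution_exists:
  fixes F :: "'a::banach \<Rightarrow> 'a"
  assumes V: "subspace V" "closed V" and F: "\<And>v. v \<in> V \<Longrightarrow> F v \<in> V" and lip: "K-lipschitz_on V F"
    and u0: "u0 \<in> V" and T: "0 \<le> T"
  obtains u where "u 0 = u0" "\<And>t. t \<in> {0..T} \<Longrightarrow> u t \<in> V"
    "\<And>t. t \<in> {0..T} \<Longrightarrow> (u has_vector_derivative F (u t)) (at t within {0..T})"
proof -
  have K: "0 \<le> K" using lip by (rule lipschitz_on_nonneg)
  \<comment> \<open>The contraction factor will be \<open>K / L\<close>; this choice makes it at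
    most 1/2 and keeps \<open>L\<close> positive even if \<open>K\<close> is 0.\<close>
  define L where "L = 2 * K + 1"
  have L: "L > 0" "2 * K \<le> L" using K by (auto simp: L_def)
  define W where "W = {w :: real \<Rightarrow>\<^sub>C 'a. \<forall>t. w t \<in> V}"
  define f where "f w r = F (exp (L * r) *\<^sub>R apply_bcontfun w r)" for w r
  define P where "P w t = exp (- L * t) *\<^sub>R (u0 + integral {0..t} (f w))" for w t
  have fV: "f w r \<in> V" if "w \<in> W" for w r
    using that V by (auto simp: f_def W_def intro!: F subspace_scale)
  have contf: "continuous_on A (f w)" if "w \<in> W" for w A
    unfolding f_def using that V
    by (intro continuous_on_compose2[OF lipschitz_on_continuous_on[OF lip]] continuous_intros)
       (auto simp: W_def subspace_scale)
  have intf: "f w integrable_on {a..b}" if "w \<in> W" for w a b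
    using contf[OF that] by (rule integrable_continuous_real)
  have PV: "P w t \<in> V" if "w \<in> W" for w t
    unfolding P_def using V that u0
    by (intro subspace_scale subspace_add integral_in_closed_subspace intf fV) auto
  have contP: "continuous_on {0..T} (P w)" if "w \<in> W" for w
    unfolding P_def by (intro continuous_intros indefinite_integral_continuous_1 intf that)
  \<comment> \<open>Clamping the time turns \<open>P w\<close>, continuous on \<open>{0..T}\<close>,
    into a bounded continuous curve on the whole line, so that the Picard map acts on a complete
    space.\<close>
  have "\<exists>g. \<forall>w\<in>W. \<forall>t. apply_bcontfun (g w) t = P w (clamp 0 T t)"
  proof (intro exI ballI allI)
    fix w t assume "w \<in> W"
    then have "continuous_on (cbox 0 T) (P w)" using contP by simp
    then have "\<exists>h :: real \<Rightarrow>\<^sub>C 'a. \<forall>t. apply_bcontfun h t = P w (clamp 0 T t)"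
      by (rule continuous_on_cbox_bcontfunE) blast
    then show "apply_bcontfun (SOME h. \<forall>t. apply_bcontfun h t = P w (clamp 0 T t)) t = P w (clamp 0 T t)"
      by (rule someI2_ex) blast
  qed
  then obtain Q :: "(real \<Rightarrow>\<^sub>C 'a) \<Rightarrow> (real \<Rightarrow>\<^sub>C 'a)"
    where Q: "\<And>w t. w \<in> W \<Longrightarrow> apply_bcontfun (Q w) t = P w (clamp 0 T t)"
    by blast
  have clamp01: "clamp 0 T t \<in> {0..T}" for t :: real
    using clamp_in_interval[of 0 T t] T by auto
  have "closed W"
  proof -
    have "W = PiC UNIV (\<lambda>_. V)" by (auto simp: W_def mem_PiC_iff Pi_iff)
    then show ?thesis using closed_PiC[of UNIV "\<lambda>_. V"] V by simp
  qed
  moreover have "Q ` W \<subseteq> W" using PV by (auto simp: W_def[symmetric] Q) (auto simp: W_def Q)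
  moreover have "dist (Q w) (Q z) \<le> 1/2 * dist w z" if wz: "w \<in> W" "z \<in> W" for w z
  proof (rule dist_bound)
    fix t0
    define t where "t = clamp 0 T t0"
    have t: "0 \<le> t" "t \<le> T" using clamp01[of t0] by (auto simp: t_def)
    have fd: "norm (f w r - f z r) \<le> K * dist w z * exp (L * r)" for r
    proof -
      have "norm (f w r - f z r) \<le> K * norm (exp (L * r) *\<^sub>R w r - exp (L * r) *\<^sub>R z r)"
        unfolding f_def dist_norm[symmetric] using wz V
        by (intro lipschitz_onD[OF lip]) (auto simp: W_def subspace_scale)
      also have "\<dots> = K * (exp (L * r) * dist (w r) (z r))"
        by (simp add: dist_norm flip: scaleR_diff_right)
      also have "\<dots> \<le> K * (exp (L * r) * dist w z)"
        using K by (intro mult_left_mono dist_bounded) auto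
      finally show ?thesis by (simp add: mult_ac)
    qed
    \<comment> \<open>The weight pays off here: the integral of \<open>K * exp (L * r)\<close> up to
      \<open>t\<close> is at most \<open>K / L\<close> times \<open>exp (L * t)\<close>, and the
      prefactor \<open>exp (- L * t)\<close> cancels the exponential.\<close>
    have hi: "((\<lambda>r. K * dist w z * exp (L * r)) has_integral
        K * dist w z * exp (L * t) / L - K * dist w z * exp (L * 0) / L) {0..t}"
      using t L by (intro fundamental_theorem_of_calculus)
        (auto intro!: derivative_eq_intros simp: has_real_derivative_iff_has_vector_derivative[symmetric])
    have "norm (integral {0..t} (f w) - integral {0..t} (f z)) = norm (integral {0..t} (\<lambda>r. f w r - f z r))"
      using intf wz by (simp add: integral_diff)
    also have "\<dots> \<le> integral {0..t} (\<lambda>r. K * dist w z * exp (L * r))"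
      using hi fd wz intf
      by (intro integral_norm_bound_integral integrable_diff) (auto intro: has_integral_integrable)
    also have "\<dots> \<le> K * dist w z * exp (L * t) / L"
      using integral_unique[OF hi] K L by simp
    also have "\<dots> \<le> exp (L * t) * (1/2 * dist w z)"
      using L mult_right_mono[OF L(2), of "dist w z * exp (L * t)"] by (simp add: field_simps)
    finally have *: "norm (integral {0..t} (f w) - integral {0..t} (f z)) \<le> exp (L * t) * (1/2 * dist w z)" .
    have "dist (Q w t0) (Q z t0) = exp (- L * t) * norm (integral {0..t} (f w) - integral {0..t} (f z))"
      using wz by (simp add: Q P_def dist_norm t_def[symmetric] flip: scaleR_diff_right)
    also have "\<dots> \<le> exp (- L * t) * (exp (L * t) * (1/2 * dist w z))"
      by (intro mult_left_mono *) auto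
    also have "\<dots> = 1/2 * dist w z" by (simp add: exp_minus)
    finally show "dist (Q w t0) (Q z t0) \<le> 1/2 * dist w z" .
  qed
  moreover have "W \<noteq> {}"
    using V by (auto simp: W_def subspace_0 intro!: exI[of _ 0])
  ultimately obtain w where w: "w \<in> W" "Q w = w"
    using Banach_fix[of W "1/2" Q] by (auto simp: complete_eq_closed)
  define u where "u t = u0 + integral {0..t} (f w)" for t
  have wu: "exp (L * t) *\<^sub>R w t = u t" if "t \<in> {0..T}" for t
  proof -
    have "apply_bcontfun w t = P w t"
      using Q[OF w(1), of t] that by (simp add: w(2) clamp_cancel_cbox)
    then show ?thesis by (simp add: P_def u_def exp_minus)
  qed
  show thesis
  proof
    show "u 0 = u0" by (simp add: u_def)
    fix t assume t: "t \<in> {0..T}"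
    show "u t \<in> V"
      using wu[OF t] w(1) V by (auto simp: W_def subspace_scale simp flip: wu[OF t])
    have "((\<lambda>t. integral {0..t} (f w)) has_vector_derivative f w t) (at t within {0..T})"
      using contf[OF w(1)] t by (intro integral_has_vector_derivative)
    then show "(u has_vector_derivative F (u t)) (at t within {0..T})"
      unfolding u_def[abs_def] using wu[OF t]
      by (auto simp: f_def u_def intro!: derivative_eq_intros)
  qed
qed

subsection \<open>Curves differentiable uniformly along a filter\<close>

text \<open>With \<open>F\<close> the principal filter of a set this is differentiability in the supremum norm, with \<open>F\<close>
  the almost-everywhere filter it is differentiability in \<open>L\<^sup>\<infinity>\<close>.\<close>

definition has_unif_deriv ::
  "'b filter \<Rightarrow> real \<Rightarrow> (real \<Rightarrow> 'b \<Rightarrow> real) \<Rightarrow> ('b \<Rightarrow> real) \<Rightarrow> real \<Rightarrow> bool" where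
  "has_unif_deriv F T u v t \<longleftrightarrow> (\<forall>e>0. \<exists>d>0. \<forall>r\<in>{0..T}. \<bar>r - t\<bar> < d \<longrightarrow>
     (\<forall>\<^sub>F s in F. \<bar>u r s - u t s - (r - t) * v s\<bar> \<le> e * \<bar>r - t\<bar>))"

lemma has_unif_deriv_mono: "has_unif_deriv F T u v t \<Longrightarrow> F' \<le> F \<Longrightarrow> has_unif_deriv F' T u v t"
  unfolding has_unif_deriv_def by (meson filter_leD)

lemma has_unif_deriv_pointwise:
  assumes "has_unif_deriv (principal A) T u v t" "s \<in> A"
  shows "((\<lambda>t. u t s) has_real_derivative v s) (at t within {0..T})"
  unfolding has_field_derivative_def has_derivative_within_alt
proof (intro conjI allI impI bounded_linear_mult_right)
  fix e :: real assume "e > 0"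
  then obtain d where d: "d > 0" "\<And>r s. r \<in> {0..T} \<Longrightarrow> \<bar>r - t\<bar> < d \<Longrightarrow> s \<in> A \<Longrightarrow>
      \<bar>u r s - u t s - (r - t) * v s\<bar> \<le> e * \<bar>r - t\<bar>"
    using assms(1) unfolding has_unif_deriv_def eventually_principal by metis
  then show "\<exists>d>0. \<forall>r\<in>{0..T}. norm (r - t) < d \<longrightarrow>
      norm (u r s - u t s - v s * (r - t)) \<le> e * norm (r - t)"
    using assms(2) by (intro exI[of _ d]) (simp add: mult.commute)
qed

lemma has_unif_deriv_iff_quotient:
  "has_unif_deriv F T u v t \<longleftrightarrow>
    (\<forall>e>0. \<forall>\<^sub>F r in at t within {0..T}. \<forall>\<^sub>F s in F. \<bar>(u r s - u t s) / (r - t) - v s\<bar> \<le> e)"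
proof -
  have eq: "\<bar>(u r s - u t s) / (r - t) - v s\<bar> \<le> e \<longleftrightarrow> \<bar>u r s - u t s - (r - t) * v s\<bar> \<le> e * \<bar>r - t\<bar>"
    if "r \<noteq> t" for r s e
  proof -
    have "(u r s - u t s) / (r - t) - v s = (u r s - u t s - (r - t) * v s) / (r - t)"
      using that by (simp add: field_simps)
    then show ?thesis using that by (simp add: abs_divide pos_divide_le_eq)
  qed
  have "(\<forall>r\<in>{0..T}. \<bar>r - t\<bar> < d \<longrightarrow> (\<forall>\<^sub>F s in F. \<bar>u r s - u t s - (r - t) * v s\<bar> \<le> e * \<bar>r - t\<bar>)) \<longleftrightarrow>
      (\<forall>r\<in>{0..T}. r \<noteq> t \<and> dist r t < d \<longrightarrow> (\<forall>\<^sub>F s in F. \<bar>(u r s - u t s) / (r - t) - v s\<bar> \<le> e))" for d e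
    by (rule ball_cong[OF refl]) (auto simp: eq dist_real_def)
  then show ?thesis
    unfolding has_unif_deriv_def eventually_at by simp
qed

lemma has_unif_deriv_continuous:
  assumes der: "has_unif_deriv F T u v t" and v: "\<forall>\<^sub>F s in F. \<bar>v s\<bar> \<le> b" and e: "e > 0"
  shows "\<exists>d>0. \<forall>r\<in>{0..T}. \<bar>r - t\<bar> < d \<longrightarrow> (\<forall>\<^sub>F s in F. \<bar>u r s - u t s\<bar> \<le> e)"
proof -
  obtain d where d: "d > 0" "\<And>r. r \<in> {0..T} \<Longrightarrow> \<bar>r - t\<bar> < d \<Longrightarrow>
      (\<forall>\<^sub>F s in F. \<bar>u r s - u t s - (r - t) * v s\<bar> \<le> 1 * \<bar>r - t\<bar>)"
    using der unfolding has_unif_deriv_def by (meson zero_less_one)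
  \<comment> \<open>With error rate 1 in the derivative, increments are at most
    \<open>\<bar>r - t\<bar> * (\<bar>b\<bar> + 1)\<close>, which this radius keeps below
    \<open>e\<close>.\<close>
  define d' where "d' = min d (e / (\<bar>b\<bar> + 1))"
  have "\<forall>\<^sub>F s in F. \<bar>u r s - u t s\<bar> \<le> e" if r: "r \<in> {0..T}" "\<bar>r - t\<bar> < d'" for r
  proof -
    have le: "\<bar>r - t\<bar> * (\<bar>b\<bar> + 1) \<le> e" using r(2) by (simp add: d'_def pos_less_divide_eq less_imp_le)
    have "\<forall>\<^sub>F s in F. \<bar>u r s - u t s - (r - t) * v s\<bar> \<le> 1 * \<bar>r - t\<bar>"
      using r by (intro d(2)) (auto simp: d'_def)
    then show ?thesis
      using v
    proof eventually_elim
      case (elim s)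
      have "\<bar>u r s - u t s\<bar> \<le> \<bar>u r s - u t s - w\<bar> + \<bar>w\<bar>" for w by linarith
      also have "\<bar>u r s - u t s - (r - t) * v s\<bar> + \<bar>(r - t) * v s\<bar> \<le> 1 * \<bar>r - t\<bar> + \<bar>r - t\<bar> * \<bar>b\<bar>"
        unfolding abs_mult using elim by (intro add_mono mult_left_mono) auto
      finally have "\<bar>u r s - u t s\<bar> \<le> 1 * \<bar>r - t\<bar> + \<bar>r - t\<bar> * \<bar>b\<bar>" .
      then show "\<bar>u r s - u t s\<bar> \<le> e" using le by (simp add: algebra_simps)
    qed
  qed
  moreover have "d' > 0" using d(1) e by (simp add: d'_def add_nonneg_pos)
  ultimately show ?thesis by blast
qed

text \<open>Compactness of the time interval: differentiability with bounded derivative gives a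
  bound near each time, and bisection glues the local bounds. A given solution is known to be
  bounded only at each single time, whereas the Gronwall argument needs one box for all
  times.\<close>

lemma uniformly_bounded_curve:
  fixes u :: "real \<Rightarrow> 'b \<Rightarrow> real"
  assumes T: "0 \<le> T"
    and der: "\<And>t. t \<in> {0..T} \<Longrightarrow> \<exists>v b. has_unif_deriv F T u v t \<and> (\<forall>\<^sub>F s in F. \<bar>v s\<bar> \<le> b)"
    and u: "\<And>t. t \<in> {0..T} \<Longrightarrow> \<exists>b. \<forall>\<^sub>F s in F. \<bar>u t s\<bar> \<le> b"
  obtains b where "0 \<le> b" "\<And>t. t \<in> {0..T} \<Longrightarrow> \<forall>\<^sub>F s in F. \<bar>u t s\<bar> \<le> b"
proof -
  define Q where "Q p q \<longleftrightarrow> (\<exists>c. \<forall>t\<in>{p..q}. t \<in> {0..T} \<longrightarrow> (\<forall>\<^sub>F s in F. \<bar>u t s\<bar> \<le> c))" for p q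
  have "Q 0 T"
  proof (rule Bolzano[OF T])
    fix p q r assume "Q p q" "Q q r"
    then obtain c1 c2 where
      c: "\<And>t. t \<in> {p..q} \<Longrightarrow> t \<in> {0..T} \<Longrightarrow> \<forall>\<^sub>F s in F. \<bar>u t s\<bar> \<le> c1"
         "\<And>t. t \<in> {q..r} \<Longrightarrow> t \<in> {0..T} \<Longrightarrow> \<forall>\<^sub>F s in F. \<bar>u t s\<bar> \<le> c2"
      unfolding Q_def by metis
    have "\<forall>\<^sub>F s in F. \<bar>u t s\<bar> \<le> max c1 c2" if "t \<in> {p..r}" "t \<in> {0..T}" for t
    proof (cases "t \<le> q")
      case True
      then have "\<forall>\<^sub>F s in F. \<bar>u t s\<bar> \<le> c1" using c(1) that by auto
      then show ?thesis by eventually_elim auto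
    next
      case False
      then have "\<forall>\<^sub>F s in F. \<bar>u t s\<bar> \<le> c2" using c(2) that by auto
      then show ?thesis by eventually_elim auto
    qed
    then show "Q p r" unfolding Q_def by blast
  next
    fix t assume t: "0 \<le> t" "t \<le> T"
    then have t': "t \<in> {0..T}" by simp
    obtain v b where "has_unif_deriv F T u v t" "\<forall>\<^sub>F s in F. \<bar>v s\<bar> \<le> b" using der[OF t'] by blast
    from has_unif_deriv_continuous[OF this zero_less_one]
    obtain d where d: "d > 0" "\<And>r. r \<in> {0..T} \<Longrightarrow> \<bar>r - t\<bar> < d \<Longrightarrow> \<forall>\<^sub>F s in F. \<bar>u r s - u t s\<bar> \<le> 1"
      by blast
    obtain c where c: "\<forall>\<^sub>F s in F. \<bar>u t s\<bar> \<le> c" using u[OF t'] by blast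
    have "\<forall>\<^sub>F s in F. \<bar>u r s\<bar> \<le> c + 1" if "r \<in> {0..T}" "\<bar>r - t\<bar> < d" for r
      using d(2)[OF that] c by eventually_elim linarith
    then have "\<forall>r\<in>{p..q}. r \<in> {0..T} \<longrightarrow> (\<forall>\<^sub>F s in F. \<bar>u r s\<bar> \<le> c + 1)"
      if "p \<le> t \<and> t \<le> q \<and> q - p < d" for p q
      using that by auto
    then show "\<exists>d>0. \<forall>p q. p \<le> t \<and> t \<le> q \<and> q - p < d \<longrightarrow> Q p q"
      unfolding Q_def using d(1) by blast
  qed
  then obtain c where c: "\<And>t. t \<in> {0..T} \<Longrightarrow> \<forall>\<^sub>F s in F. \<bar>u t s\<bar> \<le> c"
    unfolding Q_def by blast
  have "\<forall>\<^sub>F s in F. \<bar>u t s\<bar> \<le> \<bar>c\<bar>" if "t \<in> {0..T}" for t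
    using c[OF that] by eventually_elim auto
  then show thesis using that[of "\<bar>c\<bar>"] by simp
qed

lemma has_unif_deriv_diff:
  assumes "has_unif_deriv F T u v t" "has_unif_deriv F T w z t"
  shows "has_unif_deriv F T (\<lambda>t s. u t s - w t s) (\<lambda>s. v s - z s) t"
  unfolding has_unif_deriv_iff_quotient
proof (intro allI impI)
  fix e :: real assume "e > 0"
  then have "e / 2 > 0" by simp
  with assms have "\<forall>\<^sub>F r in at t within {0..T}. \<forall>\<^sub>F s in F. \<bar>(u r s - u t s) / (r - t) - v s\<bar> \<le> e / 2"
    "\<forall>\<^sub>F r in at t within {0..T}. \<forall>\<^sub>F s in F. \<bar>(w r s - w t s) / (r - t) - z s\<bar> \<le> e / 2"
    unfolding has_unif_deriv_iff_quotient by blast+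
  then show "\<forall>\<^sub>F r in at t within {0..T}. \<forall>\<^sub>F s in F.
      \<bar>((u r s - w r s) - (u t s - w t s)) / (r - t) - (v s - z s)\<bar> \<le> e"
  proof eventually_elim
    case (elim r)
    then show ?case
    proof eventually_elim
      case (elim s)
      have "((u r s - w r s) - (u t s - w t s)) / (r - t) - (v s - z s)
          = ((u r s - u t s) / (r - t) - v s) - ((w r s - w t s) / (r - t) - z s)"
        by (simp add: diff_divide_distrib)
      then show ?case using elim by linarith
    qed
  qed
qed

lemma has_unif_deriv_cong:
  assumes "has_unif_deriv F T u v t" "\<forall>\<^sub>F s in F. v s = v' s"
  shows "has_unif_deriv F T u v' t"
  unfolding has_unif_deriv_iff_quotient
proof (intro allI impI)
  fix e :: real assume "e > 0"
  then have "\<forall>\<^sub>F r in at t within {0..T}. \<forall>\<^sub>F s in F. \<bar>(u r s - u t s) / (r - t) - v s\<bar> \<le> e"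
    using assms(1) unfolding has_unif_deriv_iff_quotient by blast
  then show "\<forall>\<^sub>F r in at t within {0..T}. \<forall>\<^sub>F s in F. \<bar>(u r s - u t s) / (r - t) - v' s\<bar> \<le> e"
  proof eventually_elim
    case (elim r)
    then show ?case using assms(2) by eventually_elim simp
  qed
qed

text \<open>This is the form in which a derivative enters the Gronwall step. The radius
  \<open>d\<close> is chosen before \<open>c\<close> and \<open>k\<close>, as
  \<open>dini_gronwall_bounds\<close> asks for one radius valid for all bounds at once.\<close>

lemma has_unif_deriv_step:
  assumes der: "has_unif_deriv F T u v t" and t: "t \<in> {0..T}" and e: "e > 0"
  obtains d where "d > 0" "\<And>r c k. r \<in> {t<..T} \<Longrightarrow> r < t + d \<Longrightarrow> \<forall>\<^sub>F s in F. \<bar>u t s\<bar> \<le> c \<Longrightarrow>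
    \<forall>\<^sub>F s in F. \<bar>v s\<bar> \<le> k \<Longrightarrow> \<forall>\<^sub>F s in F. \<bar>u r s\<bar> \<le> c + (r - t) * (k + e)"
proof -
  obtain d where d: "d > 0" "\<And>r. r \<in> {0..T} \<Longrightarrow> \<bar>r - t\<bar> < d \<Longrightarrow>
      (\<forall>\<^sub>F s in F. \<bar>u r s - u t s - (r - t) * v s\<bar> \<le> e * \<bar>r - t\<bar>)"
    using der e unfolding has_unif_deriv_def by meson
  have "\<forall>\<^sub>F s in F. \<bar>u r s\<bar> \<le> c + (r - t) * (k + e)"
    if r: "r \<in> {t<..T}" "r < t + d" and ev: "\<forall>\<^sub>F s in F. \<bar>u t s\<bar> \<le> c" "\<forall>\<^sub>F s in F. \<bar>v s\<bar> \<le> k" for r c k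
  proof -
    have "\<forall>\<^sub>F s in F. \<bar>u r s - u t s - (r - t) * v s\<bar> \<le> e * \<bar>r - t\<bar>"
      using r t by (intro d(2)) auto
    then show ?thesis
      using ev
    proof eventually_elim
      case (elim s)
      have "\<bar>(r - t) * v s\<bar> \<le> (r - t) * k"
        unfolding abs_mult using elim(3) r by (intro mult_mono) auto
      moreover have "\<bar>u r s\<bar> \<le> \<bar>u r s - u t s - w\<bar> + \<bar>u t s\<bar> + \<bar>w\<bar>" for w by linarith
      from this[of "(r - t) * v s"]
      have "\<bar>u r s\<bar> \<le> \<bar>u r s - u t s - (r - t) * v s\<bar> + \<bar>u t s\<bar> + \<bar>(r - t) * v s\<bar>" .
      ultimately have "\<bar>u r s\<bar> \<le> e * \<bar>r - t\<bar> + c + (r - t) * k"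
        using elim(1,2) by (meson add_mono order_trans)
      then show ?case using r by (simp add: algebra_simps)
    qed
  qed
  then show thesis using d(1) that by blast
qed

subsection \<open>The space of bounded functions\<close>

abbreviation clip :: "real \<Rightarrow> real \<Rightarrow> real" where
  "clip R z \<equiv> max (- R) (min R z)"

lemma clip_diff_le: "\<bar>clip R z - clip R w\<bar> \<le> \<bar>z - w\<bar>"
  by linarith

lemma continuous_on_discrete: "continuous_on A (f :: 'b discrete \<Rightarrow> 'c::topological_space)"
  unfolding continuous_on_topological
proof (intro ballI allI impI)
  fix x B assume "f x \<in> B"
  then show "\<exists>U. open U \<and> x \<in> U \<and> (\<forall>y\<in>A. y \<in> U \<longrightarrow> f y \<in> B)"
    by (intro exI[of _ "{x}"]) (auto simp: open_discrete)
qed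

text \<open>All bounded functions, as the bounded continuous functions on the discrete copy of the type.\<close>

type_synonym 'b bfun = "'b discrete \<Rightarrow>\<^sub>C real"

definition ap :: "'b bfun \<Rightarrow> 'b \<Rightarrow> real" where
  "ap u s = apply_bcontfun u (discrete s)"

definition bfun :: "('b \<Rightarrow> real) \<Rightarrow> 'b bfun" where
  "bfun f = Bcontfun (\<lambda>p. f (of_discrete p))"

lemma ap_bfun:
  assumes "\<And>s. \<bar>f s\<bar> \<le> b"
  shows "ap (bfun f) s = f s"
proof -
  have "(\<lambda>p. f (of_discrete p)) \<in> bcontfun"
    using assms by (intro bcontfun_normI[of _ b] continuous_on_discrete) auto
  then show ?thesis by (simp add: ap_def bfun_def Bcontfun_inverse discrete_inverse)
qed

lemma ap_simps [simp]: "ap (u + v) s = ap u s + ap v s" "ap (u - v) s = ap u s - ap v s"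
    "ap (k *\<^sub>R u) s = k * ap u s" "ap 0 s = 0"
  by (simp_all add: ap_def)

lemma abs_ap_le: "\<bar>ap u s\<bar> \<le> norm u"
  unfolding ap_def real_norm_def[symmetric] by (rule norm_bounded)

lemma norm_bfun_le: "(\<And>s. \<bar>ap u s\<bar> \<le> b) \<Longrightarrow> norm u \<le> b"
  unfolding ap_def by (intro norm_bound) (metis (no_types) of_discrete_inverse real_norm_def)

text \<open>Norm convergence implies pointwise convergence, and pointwise limits of measurable
  functions are measurable.\<close>

lemma closed_measurable_bfun: "closed {u :: 'b bfun. ap u \<in> borel_measurable M}"
  unfolding closed_sequential_limits
proof safe
  fix f :: "nat \<Rightarrow> 'b bfun" and u
  assume meas: "\<forall>n. f n \<in> {u. ap u \<in> borel_measurable M}" and lim: "f \<longlonglongrightarrow> u"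
  have ptw: "(\<lambda>n. ap (f n) s) \<longlonglongrightarrow> ap u s" for s
    unfolding ap_def using tendsto_bcontfun_uniform_limit[OF lim]
    by (rule tendsto_uniform_limitI) simp
  show "ap u \<in> borel_measurable M"
    by (rule borel_measurable_LIMSEQ_real[OF ptw]) (use meas in simp)
qed

lemma norm_Pair_le_add: "norm (p, q) \<le> norm p + norm q"
  unfolding norm_Pair by (rule sqrt_sum_squares_le_sum) auto

instance bcontfun :: (metric_space, banach) banach ..

lemma unif_continuous_component:
  fixes g :: "real \<Rightarrow> 'b bfun"
  assumes "continuous_on A g" "t \<in> A" "e > 0"
  shows "\<exists>d>0. \<forall>r\<in>A. \<bar>r - t\<bar> < d \<longrightarrow> (\<forall>s. \<bar>ap (g r) s - ap (g t) s\<bar> \<le> e)"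
proof -
  obtain d where d: "d > 0" "\<And>r. r \<in> A \<Longrightarrow> dist r t < d \<Longrightarrow> dist (g r) (g t) < e"
    using assms unfolding continuous_on_iff by metis
  have "\<bar>ap (g r) s - ap (g t) s\<bar> \<le> e" if "r \<in> A" "\<bar>r - t\<bar> < d" for r s
    using d(2)[of r] that abs_ap_le[of "g r - g t" s] by (simp add: dist_norm)
  then show ?thesis using d(1) by blast
qed

lemma has_unif_deriv_component:
  fixes g :: "real \<Rightarrow> 'b bfun"
  assumes "(g has_vector_derivative v) (at t within {0..T})"
  shows "has_unif_deriv (principal UNIV) T (\<lambda>t. ap (g t)) (ap v) t"
  unfolding has_unif_deriv_def eventually_principal
proof (intro allI impI)
  fix e :: real assume "e > 0"
  then obtain d where d: "d > 0" "\<And>r. r \<in> {0..T} \<Longrightarrow> norm (r - t) < d \<Longrightarrow>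
      norm (g r - g t - (r - t) *\<^sub>R v) \<le> e * norm (r - t)"
    using assms unfolding has_vector_derivative_def has_derivative_within_alt by metis
  have "\<bar>ap (g r) s - ap (g t) s - (r - t) * ap v s\<bar> \<le> e * \<bar>r - t\<bar>"
    if "r \<in> {0..T}" "\<bar>r - t\<bar> < d" for r s
    using d(2)[of r] that abs_ap_le[of "g r - g t - (r - t) *\<^sub>R v" s] by simp
  then show "\<exists>d>0. \<forall>r\<in>{0..T}. \<bar>r - t\<bar> < d \<longrightarrow>
      (\<forall>s\<in>UNIV. \<bar>ap (g r) s - ap (g t) s - (r - t) * ap v s\<bar> \<le> e * \<bar>r - t\<bar>)"
    using d(1) by blast
qed

subsection \<open>The dynamics on a probability space\<close>

lemma (in prob_space) abs_integral_diff_le: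
  fixes f g :: "'a \<Rightarrow> real"
  assumes "f \<in> borel_measurable M" "g \<in> borel_measurable M"
    and "AE s in M. \<bar>f s\<bar> \<le> b" "AE s in M. \<bar>g s\<bar> \<le> b'" "AE s in M. \<bar>f s - g s\<bar> \<le> c"
  shows "\<bar>(\<integral>s. f s \<partial>M) - (\<integral>s. g s \<partial>M)\<bar> \<le> c"
proof -
  have i: "integrable M f" "integrable M g"
    using assms by (intro integrable_const_bound[where B = b] integrable_const_bound[where B = b']; simp)+
  have "\<bar>(\<integral>s. f s \<partial>M) - (\<integral>s. g s \<partial>M)\<bar> = \<bar>\<integral>s. f s - g s \<partial>M\<bar>"
    using i by simp
  also have "\<dots> \<le> (\<integral>s. \<bar>f s - g s\<bar> \<partial>M)"
    by (rule integral_abs_bound)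
  also have "\<dots> \<le> (\<integral>s. c \<partial>M)"
    using assms i by (intro integral_mono_AE) auto
  finally show ?thesis by (simp add: prob_space)
qed

lemma (in prob_space) integral_abs_le:
  fixes f :: "'a \<Rightarrow> real"
  assumes "f \<in> borel_measurable M" "AE s in M. \<bar>f s\<bar> \<le> b"
  shows "(\<integral>s. \<bar>f s\<bar> \<partial>M) \<le> b" and "integrable M f"
proof -
  show i: "integrable M f"
    using assms by (intro integrable_const_bound[where B = b]) auto
  have "(\<integral>s. \<bar>f s\<bar> \<partial>M) \<le> (\<integral>s. b \<partial>M)"
    using assms i by (intro integral_mono_AE) auto
  then show "(\<integral>s. \<bar>f s\<bar> \<partial>M) \<le> b" by (simp add: prob_space)
qed

text \<open>Telescoping, one factor at a time. Taking the last factors equal to 1 gives the estimate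
  for products of two.\<close>

lemma abs_mult3_diff_le:
  fixes p q r p' q' r' :: real
  assumes "\<bar>q\<bar> \<le> Q" "\<bar>r\<bar> \<le> R" "\<bar>p'\<bar> \<le> P" "\<bar>q'\<bar> \<le> Q"
    and "\<bar>p - p'\<bar> \<le> dp" "\<bar>q - q'\<bar> \<le> dq" "\<bar>r - r'\<bar> \<le> dr"
  shows "\<bar>p * q * r - p' * q' * r'\<bar> \<le> dp * Q * R + P * dq * R + P * Q * dr"
proof -
  have "p * q * r - p' * q' * r' = (p - p') * q * r + p' * (q - q') * r + p' * q' * (r - r')"
    by (simp add: algebra_simps)
  also have "\<bar>\<dots>\<bar> \<le> \<bar>p - p'\<bar> * \<bar>q\<bar> * \<bar>r\<bar> + \<bar>p'\<bar> * \<bar>q - q'\<bar> * \<bar>r\<bar> + \<bar>p'\<bar> * \<bar>q'\<bar> * \<bar>r - r'\<bar>"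
    unfolding abs_mult[symmetric] by linarith
  also have "\<dots> \<le> dp * Q * R + P * dq * R + P * Q * dr"
    using assms by (intro add_mono mult_mono) (auto intro: order_trans[OF abs_ge_zero])
  finally show ?thesis .
qed

text \<open>The error in the derivative is uniform in \<open>s\<close>, and integrating it over
  total mass 1 does not enlarge it.\<close>

lemma (in prob_space) has_real_derivative_integral:
  assumes der: "has_unif_deriv (principal UNIV) T u v t" and t: "t \<in> {0..T}"
    and u: "\<And>t. t \<in> {0..T} \<Longrightarrow> integrable M (u t)" and v: "integrable M v"
  shows "((\<lambda>t. \<integral>s. u t s \<partial>M) has_real_derivative (\<integral>s. v s \<partial>M)) (at t within {0..T})"
  unfolding has_field_derivative_def has_derivative_within_alt
proof (intro conjI allI impI bounded_linear_mult_right)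
  fix e :: real assume "e > 0"
  then obtain d where d: "d > 0" "\<And>r s. r \<in> {0..T} \<Longrightarrow> \<bar>r - t\<bar> < d \<Longrightarrow>
      \<bar>u r s - u t s - (r - t) * v s\<bar> \<le> e * \<bar>r - t\<bar>"
    using der unfolding has_unif_deriv_def eventually_principal by (metis UNIV_I)
  have "norm ((\<integral>s. u r s \<partial>M) - (\<integral>s. u t s \<partial>M) - (\<integral>s. v s \<partial>M) * (r - t)) \<le> e * norm (r - t)"
    if r: "r \<in> {0..T}" "norm (r - t) < d" for r
  proof -
    have "(\<integral>s. u r s \<partial>M) - (\<integral>s. u t s \<partial>M) - (\<integral>s. v s \<partial>M) * (r - t)
        = (\<integral>s. u r s - u t s - (r - t) * v s \<partial>M)"
      using u[OF r(1)] u[OF t] v by simp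
    also have "norm \<dots> \<le> (\<integral>s. \<bar>u r s - u t s - (r - t) * v s\<bar> \<partial>M)"
      unfolding real_norm_def by (rule integral_abs_bound)
    also have "\<dots> \<le> (\<integral>s. e * \<bar>r - t\<bar> \<partial>M)"
      using u[OF r(1)] u[OF t] v d(2)[OF r(1)] r(2) by (intro integral_mono) auto
    finally show ?thesis by (simp add: prob_space)
  qed
  then show "\<exists>d>0. \<forall>r\<in>{0..T}. norm (r - t) < d \<longrightarrow>
      norm ((\<integral>s. u r s \<partial>M) - (\<integral>s. u t s \<partial>M) - (\<integral>s. v s \<partial>M) * (r - t)) \<le> e * norm (r - t)"
    using d(1) by blast
qed

text \<open>Here \<open>c * sgn z + \<rho> z\<close> is \<open>\<sigma> z\<close>, and \<open>\<xi>\<close> is the initial state whose order is used to freeze the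
  jump term.\<close>

locale opinion_dynamics = prob_space M for M :: "'a measure" +
  fixes a \<rho> :: "real \<Rightarrow> real" and \<xi> :: "'a \<Rightarrow> real" and c l S q :: real
  assumes a_lip: "\<bar>a z - a w\<bar> \<le> l * \<bar>z - w\<bar>" and a0: "a 0 = 0" and l: "0 \<le> l"
    and \<rho>_lip: "\<bar>\<rho> z - \<rho> w\<bar> \<le> S * \<bar>z - w\<bar>" and \<rho>_odd: "\<rho> (- z) = - \<rho> z" and S: "0 \<le> S"
    and \<xi>[measurable]: "\<xi> \<in> borel_measurable M"
    and kernel_bound: "\<bar>c * sgn (\<xi> s - \<xi> s') + \<rho> z\<bar> \<le> q"
begin

definition H :: "('a \<Rightarrow> real) \<Rightarrow> ('a \<Rightarrow> real) \<Rightarrow> 'a \<Rightarrow> real" where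
  "H x m s = (\<integral>s1. m s1 * a (x s1 - x s) \<partial>M)"

text \<open>The sign is taken at \<open>\<xi>\<close> and not at \<open>x\<close>. The kernel is
  thus Lipschitz in \<open>x\<close>, and it remains antisymmetric in its two points.\<close>

definition ker :: "('a \<Rightarrow> real) \<Rightarrow> 'a \<Rightarrow> 'a \<Rightarrow> real" where
  "ker x s s1 = c * sgn (\<xi> s - \<xi> s1) + \<rho> (x s - x s1)"

definition G :: "('a \<Rightarrow> real) \<Rightarrow> ('a \<Rightarrow> real) \<Rightarrow> 'a \<Rightarrow> real" where
  "G x m s = (\<integral>s1. m s1 * (H x m s + H x m s1) * ker x s s1 \<partial>M)"

section \<open>Measurability, bounds and Lipschitz estimates for \<open>H\<close> and
  \<open>G\<close>\<close>

lemma measurable_a[measurable]: "a \<in> borel_measurable borel"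
proof -
  have "l-lipschitz_on UNIV a"
    using a_lip l by (intro lipschitz_onI) (auto simp: dist_real_def)
  then show ?thesis
    by (intro borel_measurable_continuous_onI lipschitz_on_continuous_on)
qed

lemma measurable_\<rho>[measurable]: "\<rho> \<in> borel_measurable borel"
proof -
  have "S-lipschitz_on UNIV \<rho>"
    using \<rho>_lip S by (intro lipschitz_onI) (auto simp: dist_real_def)
  then show ?thesis
    by (intro borel_measurable_continuous_onI lipschitz_on_continuous_on)
qed

lemma measurable_H[measurable]:
  assumes [measurable]: "x \<in> borel_measurable M" "m \<in> borel_measurable M"
  shows "H x m \<in> borel_measurable M"
  unfolding H_def[abs_def] by measurable

lemma measurable_sgn_real[measurable]: "sgn \<in> borel_measurable (borel :: real measure)"
  unfolding sgn_if[abs_def] by measurable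

lemma measurable_ker[measurable]:
  assumes [measurable]: "x \<in> borel_measurable M"
  shows "(\<lambda>(s, s1). ker x s s1) \<in> borel_measurable (M \<Otimes>\<^sub>M M)" "ker x s \<in> borel_measurable M"
  unfolding ker_def[abs_def] by measurable

lemma measurable_G[measurable]:
  assumes [measurable]: "x \<in> borel_measurable M" "m \<in> borel_measurable M"
  shows "G x m \<in> borel_measurable M"
  unfolding G_def[abs_def] by measurable

lemma abs_a_le: "\<bar>u\<bar> \<le> R \<Longrightarrow> \<bar>v\<bar> \<le> R \<Longrightarrow> \<bar>a (u - v)\<bar> \<le> 2 * l * R"
proof -
  assume "\<bar>u\<bar> \<le> R" "\<bar>v\<bar> \<le> R"
  then have "l * \<bar>u - v\<bar> \<le> l * (2 * R)" using l by (intro mult_left_mono) auto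
  then show ?thesis using a_lip[of "u - v" 0] by (simp add: a0)
qed

text \<open>The bound goes through the integral of \<open>\<bar>m\<bar>\<close> rather than its
  supremum: mass conservation controls this integral independently of the box. The bound on
  \<open>x\<close> is also assumed at the point \<open>s\<close> itself, which could lie in the
  exceptional null set.\<close>

lemma abs_H_le:
  assumes m: "integrable M m" and x: "AE s in M. \<bar>x s\<bar> \<le> R" "\<bar>x s\<bar> \<le> R"
  shows "\<bar>H x m s\<bar> \<le> (\<integral>s. \<bar>m s\<bar> \<partial>M) * (2 * l * R)"
proof -
  have R: "0 \<le> R" using x(2) by linarith
  have "\<bar>H x m s\<bar> \<le> (\<integral>s1. \<bar>m s1 * a (x s1 - x s)\<bar> \<partial>M)"
    unfolding H_def by (rule integral_abs_bound)
  also have "\<dots> \<le> (\<integral>s1. \<bar>m s1\<bar> * (2 * l * R) \<partial>M)"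
  proof (rule integral_mono_AE')
    show "AE s1 in M. \<bar>m s1 * a (x s1 - x s)\<bar> \<le> \<bar>m s1\<bar> * (2 * l * R)"
      using x(1) by eventually_elim (auto simp: abs_mult intro!: mult_left_mono abs_a_le x)
  qed (use m l R in auto)
  finally show ?thesis by simp
qed

lemma abs_G_le:
  assumes m: "integrable M m" and x: "AE s in M. \<bar>x s\<bar> \<le> R" "\<bar>x s\<bar> \<le> R"
  shows "\<bar>G x m s\<bar> \<le> (\<integral>s. \<bar>m s\<bar> \<partial>M) * (2 * ((\<integral>s. \<bar>m s\<bar> \<partial>M) * (2 * l * R)) * q)"
proof -
  let ?h = "(\<integral>s. \<bar>m s\<bar> \<partial>M) * (2 * l * R)"
  have q: "\<bar>ker x s s1\<bar> \<le> q" for s s1 unfolding ker_def by (rule kernel_bound)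
  have "0 \<le> ?h" "0 \<le> q"
    using x(2) l q[of s s] by (auto intro!: mult_nonneg_nonneg Bochner_Integration.integral_nonneg)
  then have hq: "0 \<le> 2 * ?h * q" by simp
  have "\<bar>G x m s\<bar> \<le> (\<integral>s1. \<bar>m s1 * (H x m s + H x m s1) * ker x s s1\<bar> \<partial>M)"
    unfolding G_def by (rule integral_abs_bound)
  also have "\<dots> \<le> (\<integral>s1. \<bar>m s1\<bar> * (2 * ?h * q) \<partial>M)"
  proof (rule integral_mono_AE')
    show "AE s1 in M. \<bar>m s1 * (H x m s + H x m s1) * ker x s s1\<bar> \<le> \<bar>m s1\<bar> * (2 * ?h * q)"
      using x(1)
    proof eventually_elim
      case (elim s1)
      have "\<bar>H x m s + H x m s1\<bar> \<le> 2 * ?h"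
        using abs_H_le[OF m x(1) x(2)] abs_H_le[OF m x(1) elim] by linarith
      then have "\<bar>H x m s + H x m s1\<bar> * \<bar>ker x s s1\<bar> \<le> 2 * ?h * q"
        using \<open>0 \<le> ?h\<close> by (intro mult_mono q) auto
      then show ?case
        by (simp add: abs_mult mult.assoc mult_left_mono)
    qed
    show "AE s1 in M. 0 \<le> \<bar>m s1\<bar> * (2 * ?h * q)"
      by (intro AE_I2 mult_nonneg_nonneg[OF abs_ge_zero hq])
  qed (use m in auto)
  finally show ?thesis by simp
qed

text \<open>A cruder version with a supremum bound on \<open>m\<close>, for the places where only a
  box is known.\<close>

lemma abs_H_G_le_const:
  assumes m: "m \<in> borel_measurable M" "AE s in M. \<bar>m s\<bar> \<le> B"
    and x: "AE s in M. \<bar>x s\<bar> \<le> R" "\<bar>x s\<bar> \<le> R" and B: "0 \<le> B"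
  shows "\<bar>H x m s\<bar> \<le> B * (2 * l * R)" "\<bar>G x m s\<bar> \<le> B * (2 * (B * (2 * l * R)) * q)"
proof -
  have R: "0 \<le> R" using x(2) by linarith
  have q: "0 \<le> q" using kernel_bound[of s s 0] by linarith
  note im = integral_abs_le[OF m]
  have hB: "(\<integral>s. \<bar>m s\<bar> \<partial>M) * (2 * l * R) \<le> B * (2 * l * R)"
    using im l R by (intro mult_right_mono) auto
  show "\<bar>H x m s\<bar> \<le> B * (2 * l * R)"
    using abs_H_le[OF im(2) x] hB by linarith
  have "\<bar>G x m s\<bar> \<le> (\<integral>s. \<bar>m s\<bar> \<partial>M) * (2 * ((\<integral>s. \<bar>m s\<bar> \<partial>M) * (2 * l * R)) * q)"
    using abs_G_le[OF im(2) x] .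
  also have "\<dots> \<le> B * (2 * (B * (2 * l * R)) * q)"
    using im(1) hB q l R B by (intro mult_mono) auto
  finally show "\<bar>G x m s\<bar> \<le> B * (2 * (B * (2 * l * R)) * q)" .
qed

lemma abs_H_diff_le:
  assumes [measurable]: "x \<in> borel_measurable M" "m \<in> borel_measurable M"
      "y \<in> borel_measurable M" "n \<in> borel_measurable M"
    and m: "AE s in M. \<bar>m s\<bar> \<le> B" "AE s in M. \<bar>n s\<bar> \<le> B" "AE s in M. \<bar>m s - n s\<bar> \<le> d"
    and x: "AE s in M. \<bar>x s\<bar> \<le> R" "AE s in M. \<bar>y s\<bar> \<le> R" "AE s in M. \<bar>x s - y s\<bar> \<le> d"
    and s: "\<bar>x s\<bar> \<le> R" "\<bar>y s\<bar> \<le> R" "\<bar>x s - y s\<bar> \<le> d" and B: "0 \<le> B" and R: "0 \<le> R"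
  shows "\<bar>H x m s - H y n s\<bar> \<le> d * (2 * l * (R + B))"
  unfolding H_def
proof (rule abs_integral_diff_le[where b = "B * (2 * l * R)" and b' = "B * (2 * l * R)"])
  show "AE s1 in M. \<bar>m s1 * a (x s1 - x s)\<bar> \<le> B * (2 * l * R)"
    using m(1) x(1) by eventually_elim
      (unfold abs_mult, intro mult_mono abs_a_le s B, auto)
  show "AE s1 in M. \<bar>n s1 * a (y s1 - y s)\<bar> \<le> B * (2 * l * R)"
    using m(2) x(2) by eventually_elim
      (unfold abs_mult, intro mult_mono abs_a_le s B, auto)
  show "AE s1 in M. \<bar>m s1 * a (x s1 - x s) - n s1 * a (y s1 - y s)\<bar> \<le> d * (2 * l * (R + B))"
    using m x
  proof eventually_elim
    case (elim s1)
    have "l * \<bar>(x s1 - x s) - (y s1 - y s)\<bar> \<le> l * (2 * d)"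
      using elim s l by (intro mult_left_mono) linarith+
    then have 1: "\<bar>a (x s1 - x s) - a (y s1 - y s)\<bar> \<le> l * (2 * d)"
      by (rule order_trans[OF a_lip])
    have "\<bar>m s1 * a (x s1 - x s) * 1 - n s1 * a (y s1 - y s) * 1\<bar>
        \<le> d * (2 * l * R) * 1 + B * (l * (2 * d)) * 1 + B * (2 * l * R) * 0"
      by (rule abs_mult3_diff_le[OF abs_a_le[OF elim(4) s(1)] _ elim(2) abs_a_le[OF elim(5) s(2)] elim(3) 1]) simp_all
    then show ?case by (simp add: algebra_simps)
  qed
qed measurable

lemma abs_G_diff_le:
  assumes [measurable]: "x \<in> borel_measurable M" "m \<in> borel_measurable M"
      "y \<in> borel_measurable M" "n \<in> borel_measurable M"
    and m: "AE s in M. \<bar>m s\<bar> \<le> B" "AE s in M. \<bar>n s\<bar> \<le> B" "AE s in M. \<bar>m s - n s\<bar> \<le> d"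
    and x: "AE s in M. \<bar>x s\<bar> \<le> R" "AE s in M. \<bar>y s\<bar> \<le> R" "AE s in M. \<bar>x s - y s\<bar> \<le> d"
    and s: "\<bar>x s\<bar> \<le> R" "\<bar>y s\<bar> \<le> R" "\<bar>x s - y s\<bar> \<le> d" and B: "0 \<le> B" and R: "0 \<le> R"
  shows "\<bar>G x m s - G y n s\<bar> \<le>
    d * (4 * B * l * R * q + B * (4 * l * (R + B)) * q + B * (4 * B * l * R) * (2 * S))"
proof -
  let ?h = "4 * B * l * R"
  have q: "\<bar>ker x s s1\<bar> \<le> q" for x s s1 unfolding ker_def by (rule kernel_bound)
  have "(\<integral>s. \<bar>m s\<bar> \<partial>M) * (2 * l * R) \<le> B * (2 * l * R)" "(\<integral>s. \<bar>n s\<bar> \<partial>M) * (2 * l * R) \<le> B * (2 * l * R)"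
    using integral_abs_le(1)[OF _ m(1)] integral_abs_le(1)[OF _ m(2)] l R
    by (auto intro!: mult_right_mono)
  moreover have "integrable M m" "integrable M n"
    using integral_abs_le(2)[OF _ m(1)] integral_abs_le(2)[OF _ m(2)] by auto
  ultimately have Hb: "\<bar>x s\<bar> \<le> R \<Longrightarrow> \<bar>H x m s\<bar> \<le> B * (2 * l * R)"
      "\<bar>y s\<bar> \<le> R \<Longrightarrow> \<bar>H y n s\<bar> \<le> B * (2 * l * R)" for s
    using abs_H_le[of m x R s] abs_H_le[of n y R s] x by (metis order_trans)+
  have Hs: "\<bar>x s1\<bar> \<le> R \<Longrightarrow> \<bar>H x m s + H x m s1\<bar> \<le> ?h"
      "\<bar>y s1\<bar> \<le> R \<Longrightarrow> \<bar>H y n s + H y n s1\<bar> \<le> ?h" for s1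
    using Hb[of s] Hb[of s1] s abs_triangle_ineq[of "H x m s" "H x m s1"]
      abs_triangle_ineq[of "H y n s" "H y n s1"] by (auto simp: algebra_simps)
  show ?thesis
    unfolding G_def
  proof (rule abs_integral_diff_le[where b = "B * ?h * q" and b' = "B * ?h * q"])
    show "AE s1 in M. \<bar>m s1 * (H x m s + H x m s1) * ker x s s1\<bar> \<le> B * ?h * q"
      using m(1) x(1) by eventually_elim
        (unfold abs_mult, intro mult_mono Hs q, use B l R in auto)
    show "AE s1 in M. \<bar>n s1 * (H y n s + H y n s1) * ker y s s1\<bar> \<le> B * ?h * q"
      using m(2) x(2) by eventually_elim
        (unfold abs_mult, intro mult_mono Hs q, use B l R in auto)
    show "AE s1 in M. \<bar>m s1 * (H x m s + H x m s1) * ker x s s1 - n s1 * (H y n s + H y n s1) * ker y s s1\<bar> \<le>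
      d * (4 * B * l * R * q + B * (4 * l * (R + B)) * q + B * (4 * B * l * R) * (2 * S))"
      using m x
    proof eventually_elim
      case (elim s1)
      have "\<bar>H x m s - H y n s\<bar> \<le> d * (2 * l * (R + B))" "\<bar>H x m s1 - H y n s1\<bar> \<le> d * (2 * l * (R + B))"
        by (rule abs_H_diff_le[OF assms(1-4) m x s B R] abs_H_diff_le[OF assms(1-4) m x elim(4-6) B R])+
      then have "\<bar>(H x m s + H x m s1) - (H y n s + H y n s1)\<bar> \<le> 2 * (d * (2 * l * (R + B)))"
        by linarith
      then have 1: "\<bar>(H x m s + H x m s1) - (H y n s + H y n s1)\<bar> \<le> d * (4 * l * (R + B))"
        by (simp add: mult_ac)
      have "S * \<bar>(x s - x s1) - (y s - y s1)\<bar> \<le> S * (2 * d)"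
        using elim s S by (intro mult_left_mono) linarith+
      then have 2: "\<bar>ker x s s1 - ker y s s1\<bar> \<le> S * (2 * d)"
        using \<rho>_lip[of "x s - x s1" "y s - y s1"] by (simp add: ker_def)
      have "\<bar>m s1 * (H x m s + H x m s1) * ker x s s1 - n s1 * (H y n s + H y n s1) * ker y s s1\<bar>
          \<le> d * ?h * q + B * (d * (4 * l * (R + B))) * q + B * ?h * (S * (2 * d))"
        by (rule abs_mult3_diff_le[OF Hs(1)[OF elim(4)] q elim(2) Hs(2)[OF elim(5)] elim(3) 1 2])
      then show ?case by (simp add: algebra_simps)
    qed
  qed measurable
qed

text \<open>Conservation of mass: the double integral is antisymmetric in its two variables.\<close>

lemma integral_mult_G_eq_0:
  assumes [measurable]: "x \<in> borel_measurable M" "m \<in> borel_measurable M"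
    and m: "AE s in M. \<bar>m s\<bar> \<le> B" and x: "AE s in M. \<bar>x s\<bar> \<le> R" and R: "0 \<le> R"
  shows "(\<integral>s. m s * G x m s \<partial>M) = 0"
proof -
  interpret P: pair_prob_space M M ..
  define f where "f s s1 = m s * (m s1 * (H x m s + H x m s1) * ker x s s1)" for s s1
  have [measurable]: "(\<lambda>(s, s1). f s s1) \<in> borel_measurable (M \<Otimes>\<^sub>M M)"
    unfolding f_def by measurable
  \<comment> \<open>The sum of the two \<open>H\<close> terms is symmetric in \<open>s\<close> and
    \<open>s1\<close>, while both parts of the kernel are odd in the difference.\<close>
  have anti: "f s1 s = - f s s1" for s s1
  proof -
    have "ker x s1 s = - ker x s s1"
      using \<rho>_odd[of "x s - x s1"] sgn_minus[of "\<xi> s - \<xi> s1"] by (simp add: ker_def)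
    then show ?thesis by (simp add: f_def algebra_simps)
  qed
  have intm: "integrable M m" using m by (auto intro: integral_abs_le)
  define h where "h = (\<integral>s. \<bar>m s\<bar> \<partial>M) * (2 * l * R)"
  have h0: "0 \<le> h" using l R by (simp add: h_def)
  have fb: "\<bar>f s s1\<bar> \<le> B * (B * (2 * h) * q)"
    if "\<bar>m s\<bar> \<le> B" "\<bar>m s1\<bar> \<le> B" "\<bar>x s\<bar> \<le> R" "\<bar>x s1\<bar> \<le> R" for s s1
  proof -
    have "\<bar>H x m s + H x m s1\<bar> \<le> 2 * h"
      using abs_H_le[OF intm x that(3)] abs_H_le[OF intm x that(4)] by (simp add: h_def)
    moreover have "\<bar>ker x s s1\<bar> \<le> q" unfolding ker_def by (rule kernel_bound)
    moreover have "0 \<le> B" using that by linarith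
    ultimately show ?thesis
      using that h0 unfolding f_def abs_mult by (intro mult_mono) auto
  qed
  have "AE s in M. \<bar>m s\<bar> \<le> B \<and> \<bar>x s\<bar> \<le> R" using m x by eventually_elim auto
  then have "AE s in M. AE s1 in M. \<bar>f s s1\<bar> \<le> B * (B * (2 * h) * q)"
  proof eventually_elim
    case (elim s)
    show ?case using m x by eventually_elim (use elim in \<open>auto intro!: fb\<close>)
  qed
  then have "AE p in M \<Otimes>\<^sub>M M. norm (case p of (s, s1) \<Rightarrow> f s s1) \<le> B * (B * (2 * h) * q)"
    by (intro P.AE_pair_measure) (auto simp: split_beta')
  then have int: "integrable (M \<Otimes>\<^sub>M M) (\<lambda>(s, s1). f s s1)"
    by (intro P.P.integrable_const_bound) auto
  have "(\<integral>s. m s * G x m s \<partial>M) = (\<integral>s. (\<integral>s1. f s s1 \<partial>M) \<partial>M)"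
    by (simp add: G_def f_def)
  also have "\<dots> = (\<integral>s1. (\<integral>s. f s s1 \<partial>M) \<partial>M)"
    using P.Fubini_integral[OF int] by simp
  also have "\<dots> = (\<integral>s1. (\<integral>s. - f s1 s \<partial>M) \<partial>M)"
    by (subst anti) simp
  also have "\<dots> = - (\<integral>s. (\<integral>s1. f s s1 \<partial>M) \<partial>M)" by simp
  also have "(\<integral>s. (\<integral>s1. f s s1 \<partial>M) \<partial>M) = (\<integral>s. m s * G x m s \<partial>M)"
    by (simp add: G_def f_def)
  finally show ?thesis by simp
qed

section \<open>The clipped vector field on measurable states\<close>

text \<open>The arguments are clipped, not the values. The same clipped \<open>m\<close> serves as
  prefactor and as weight inside \<open>G\<close>, so the antisymmetry behind mass conservation
  survives.\<close>

definition field :: "real \<Rightarrow> real \<Rightarrow> 'a bfun \<times> 'a bfun \<Rightarrow> 'a bfun \<times> 'a bfun" where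
  "field R B u =
    (let x = (\<lambda>s. clip R (ap (fst u) s)); m = (\<lambda>s. clip B (ap (snd u) s))
     in (bfun (H x m), bfun (\<lambda>s. m s * G x m s)))"

text \<open>\<open>bfun\<close> contains nonmeasurable functions, for which integrals default to 0
  and cannot be estimated; the evolution is confined to this set.\<close>

definition measurable_states :: "('a bfun \<times> 'a bfun) set" where
  "measurable_states = {u. ap (fst u) \<in> borel_measurable M} \<inter> {u. ap (snd u) \<in> borel_measurable M}"

lemma subspace_measurable_states: "subspace measurable_states"
proof -
  have "ap (0 :: 'a bfun) = (\<lambda>s. 0)" "ap (u + v) = (\<lambda>s. ap u s + ap v s)" "ap (k *\<^sub>R u) = (\<lambda>s. k * ap u s)"
    for u v :: "'a bfun" and k by auto
  then show ?thesis
    unfolding subspace_def measurable_states_def by auto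
qed

lemma closed_measurable_states: "closed measurable_states"
proof -
  have "measurable_states = {u. ap u \<in> borel_measurable M} \<times> {u. ap u \<in> borel_measurable M}"
    by (auto simp: measurable_states_def)
  then show ?thesis by (simp add: closed_Times closed_measurable_bfun)
qed

text \<open>\<open>ap\<close> undoes \<open>bfun\<close> only on bounded functions, so the bounds
  provided by clipping are needed even to evaluate the field.\<close>

lemma field_ap:
  assumes u: "u \<in> measurable_states" and R: "0 \<le> R" and B: "0 \<le> B"
  defines "x \<equiv> \<lambda>s. clip R (ap (fst u) s)" and "m \<equiv> \<lambda>s. clip B (ap (snd u) s)"
  shows "x \<in> borel_measurable M" "m \<in> borel_measurable M"
    "ap (fst (field R B u)) = H x m" "ap (snd (field R B u)) = (\<lambda>s. m s * G x m s)"
    "\<bar>G x m s\<bar> \<le> B * (2 * (B * (2 * l * R)) * q)"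
proof -
  have [measurable]: "ap (fst u) \<in> borel_measurable M" "ap (snd u) \<in> borel_measurable M"
    using u by (auto simp: measurable_states_def)
  show x: "x \<in> borel_measurable M" and m: "m \<in> borel_measurable M"
    unfolding x_def m_def by measurable
  have xR: "\<bar>x s\<bar> \<le> R" and mB: "\<bar>m s\<bar> \<le> B" for s using R B by (auto simp: x_def m_def)
  have Hb: "\<bar>H x m s\<bar> \<le> B * (2 * l * R)" and Gb: "\<bar>G x m s\<bar> \<le> B * (2 * (B * (2 * l * R)) * q)" for s
    by (intro abs_H_G_le_const[OF m _ _ xR B] AE_I2 mB xR)+
  show "\<bar>G x m s\<bar> \<le> B * (2 * (B * (2 * l * R)) * q)" by (rule Gb)
  have "\<bar>m s * G x m s\<bar> \<le> B * (B * (2 * (B * (2 * l * R)) * q))" for s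
    unfolding abs_mult by (intro mult_mono mB Gb B) auto
  then show "ap (snd (field R B u)) = (\<lambda>s. m s * G x m s)"
    by (intro ext) (simp only: field_def Let_def x_def[symmetric] m_def[symmetric] snd_conv, rule ap_bfun)
  show "ap (fst (field R B u)) = H x m"
    using Hb by (intro ext) (simp only: field_def Let_def x_def[symmetric] m_def[symmetric] fst_conv, rule ap_bfun)
qed

lemma field_measurable_states:
  assumes "u \<in> measurable_states" "0 \<le> R" "0 \<le> B"
  shows "field R B u \<in> measurable_states"
  using field_ap[OF assms] unfolding measurable_states_def by (auto intro!: measurable_H measurable_G)

lemma field_lipschitz:
  assumes R: "0 \<le> R" and B: "0 \<le> B"
  obtains K where "K-lipschitz_on measurable_states (field R B)"
proof -
  have q: "0 \<le> q" using kernel_bound[of undefined undefined 0] by linarith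
  define K1 where "K1 = 2 * l * (R + B)"
  define Kg where "Kg = B * (2 * (B * (2 * l * R)) * q)"
  define K2 where "K2 = 4 * B * l * R * q + B * (4 * l * (R + B)) * q + B * (4 * B * l * R) * (2 * S)"
  have K0: "0 \<le> K1" "0 \<le> Kg" "0 \<le> K2"
    using l R B q S by (auto simp: K1_def K2_def Kg_def)
  \<comment> \<open>\<open>K1\<close> serves for \<open>H\<close>, and \<open>Kg + B * K2\<close>
    comes from the product \<open>m * G\<close>. They are added because the norm of a pair is at
    most the sum of the norms.\<close>
  show thesis
  proof (rule that[of "K1 + (Kg + B * K2)"], rule lipschitz_onI)
    fix u v assume u: "u \<in> measurable_states" and v: "v \<in> measurable_states"
    define d where "d = dist u v"
    define x where "x = (\<lambda>s. clip R (ap (fst u) s))"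
    define m where "m = (\<lambda>s. clip B (ap (snd u) s))"
    define y where "y = (\<lambda>s. clip R (ap (fst v) s))"
    define n where "n = (\<lambda>s. clip B (ap (snd v) s))"
    note fu = field_ap[OF u R B, folded x_def m_def] and fv = field_ap[OF v R B, folded y_def n_def]
    have "norm (fst (u - v)) \<le> d" "norm (snd (u - v)) \<le> d"
      using norm_fst_le[of "fst (u - v)" "snd (u - v)"] norm_snd_le[of "snd (u - v)" "fst (u - v)"]
      unfolding d_def dist_norm prod.collapse by blast+
    then have "\<bar>ap (fst u) s - ap (fst v) s\<bar> \<le> d" "\<bar>ap (snd u) s - ap (snd v) s\<bar> \<le> d" for s
      using order_trans[OF abs_ap_le[of "fst (u - v)" s]] order_trans[OF abs_ap_le[of "snd (u - v)" s]]
      by simp_all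
    then have diff: "\<bar>x s - y s\<bar> \<le> d" "\<bar>m s - n s\<bar> \<le> d" for s
      unfolding x_def y_def m_def n_def by (auto intro: order_trans[OF clip_diff_le])
    have bd: "\<bar>x s\<bar> \<le> R" "\<bar>y s\<bar> \<le> R" "\<bar>m s\<bar> \<le> B" "\<bar>n s\<bar> \<le> B" for s
      using R B by (auto simp: x_def y_def m_def n_def)
    have Hd: "\<bar>H x m s - H y n s\<bar> \<le> d * K1" for s
      unfolding K1_def using fu(1,2) fv(1,2) diff bd R B by (intro abs_H_diff_le) auto
    have Gd: "\<bar>G x m s - G y n s\<bar> \<le> d * K2" for s
      unfolding K2_def using fu(1,2) fv(1,2) diff bd R B by (intro abs_G_diff_le) auto
    have mG: "\<bar>m s * G x m s - n s * G y n s\<bar> \<le> d * (Kg + B * K2)" for s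
    proof -
      have "\<bar>m s * G x m s * 1 - n s * G y n s * 1\<bar> \<le> d * Kg * 1 + B * (d * K2) * 1 + B * Kg * 0"
        by (rule abs_mult3_diff_le[OF fu(5)[folded Kg_def] _ bd(4) fv(5)[folded Kg_def] diff(2) Gd]) simp_all
      then show ?thesis by (simp add: algebra_simps)
    qed
    have "norm (fst (field R B u - field R B v)) \<le> d * K1"
      using Hd by (intro norm_bfun_le) (simp add: fu(3) fv(3))
    moreover have "norm (snd (field R B u - field R B v)) \<le> d * (Kg + B * K2)"
      using mG by (intro norm_bfun_le) (simp add: fu(4) fv(4) m_def n_def)
    ultimately have "norm (field R B u - field R B v) \<le> d * K1 + d * (Kg + B * K2)"
      using norm_Pair_le_add[of "fst (field R B u - field R B v)" "snd (field R B u - field R B v)"]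
      unfolding prod.collapse by linarith
    then show "dist (field R B u) (field R B v) \<le> (K1 + (Kg + B * K2)) * dist u v"
      unfolding dist_norm[of "field R B u"] d_def[symmetric] by (simp add: algebra_simps)
  qed (use K0 B in auto)
qed

theorem solution_exists:
  fixes m0 :: "'a \<Rightarrow> real"
  assumes T: "0 \<le> T" and m0[measurable]: "m0 \<in> borel_measurable M"
    and m0_pos: "\<And>s. 0 < m0 s" and m0_le: "\<And>s. m0 s \<le> m_max" and mass: "(\<integral>s. m0 s \<partial>M) = 1"
    and X: "\<And>s. \<bar>\<xi> s\<bar> \<le> X"
  obtains x m R B where "x 0 = \<xi>" "m 0 = m0" "0 \<le> R" "0 \<le> B"
    "\<And>t. t \<in> {0..T} \<Longrightarrow> x t \<in> borel_measurable M"
    "\<And>t. t \<in> {0..T} \<Longrightarrow> m t \<in> borel_measurable M"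
    "\<And>t s. t \<in> {0..T} \<Longrightarrow> \<bar>x t s\<bar> \<le> R"
    "\<And>t s. t \<in> {0..T} \<Longrightarrow> \<bar>m t s\<bar> \<le> B"
    "\<And>t s. t \<in> {0..T} \<Longrightarrow> \<bar>m t s * G (x t) (m t) s\<bar> \<le> B * (B * (2 * (B * (2 * l * R)) * q))"
    "\<And>t. t \<in> {0..T} \<Longrightarrow> has_unif_deriv (principal UNIV) T x (H (x t) (m t)) t"
    "\<And>t. t \<in> {0..T} \<Longrightarrow> has_unif_deriv (principal UNIV) T m (\<lambda>s. m t s * G (x t) (m t) s) t"
    "\<And>t e. t \<in> {0..T} \<Longrightarrow> e > 0 \<Longrightarrow> \<exists>d>0. \<forall>r\<in>{0..T}. \<bar>r - t\<bar> < d \<longrightarrow>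
        (\<forall>s. \<bar>H (x r) (m r) s - H (x t) (m t) s\<bar> \<le> e)"
    "\<And>t e. t \<in> {0..T} \<Longrightarrow> e > 0 \<Longrightarrow> \<exists>d>0. \<forall>r\<in>{0..T}. \<bar>r - t\<bar> < d \<longrightarrow>
        (\<forall>s. \<bar>m r s * G (x r) (m r) s - m t s * G (x t) (m t) s\<bar> \<le> e)"
proof -
  have q: "0 \<le> q" using kernel_bound[of undefined undefined 0] by linarith
  have X0: "0 \<le> X" using X[of undefined] by linarith
  \<comment> \<open>With mass 1, \<open>x\<close> grows at rate \<open>2 * l\<close>, whatever
    \<open>B\<close> is; this fixes \<open>R\<close>. Mass 1 and \<open>R\<close> bound
    \<open>G\<close> by \<open>k\<close>, and \<open>k\<close> fixes \<open>B\<close>.\<close>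
  define R where "R = X * exp (2 * l * T)"
  define k where "k = 2 * (2 * l * R) * q"
  define B where "B = m_max * exp (k * T)"
  have R: "0 \<le> R" using X0 by (simp add: R_def)
  have k: "0 \<le> k" using l R q by (simp add: k_def)
  have "0 \<le> m_max" using m0_pos[of undefined] m0_le[of undefined] by linarith
  then have B: "0 \<le> B" and mB: "m_max \<le> B" using k T by (auto simp: B_def mult_le_cancel_left1)
  obtain K where lip: "K-lipschitz_on measurable_states (field R B)"
    using field_lipschitz[OF R B] .
  have ap0: "ap (bfun \<xi>) = \<xi>" "ap (bfun m0) = m0"
    using X m0_pos m0_le by (intro ext ap_bfun[of _ X] ap_bfun[of _ m_max]; simp add: less_imp_le)+
  have initV: "(bfun \<xi>, bfun m0) \<in> measurable_states"
    by (simp add: measurable_states_def ap0)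
  obtain u where u0: "u 0 = (bfun \<xi>, bfun m0)"
    and uV: "\<And>t. t \<in> {0..T} \<Longrightarrow> u t \<in> measurable_states"
    and du: "\<And>t. t \<in> {0..T} \<Longrightarrow> (u has_vector_derivative field R B (u t)) (at t within {0..T})"
    by (rule ode_solution_exists[OF subspace_measurable_states closed_measurable_states _ lip initV T])
      (use field_measurable_states[OF _ R B] in blast)+
  have contu: "continuous_on {0..T} u"
    unfolding continuous_on_eq_continuous_within by (intro ballI has_vector_derivative_continuous[OF du])
  define x m where "x t = ap (fst (u t))" and "m t = ap (snd (u t))" for t
  \<comment> \<open>Until the box is known not to be left, the derivatives of \<open>x\<close> and
    \<open>m\<close> are expressed through the clipped states.\<close>
  define xc mc where "xc t s = clip R (x t s)" and "mc t s = clip B (m t s)" for t s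
  note fa = field_ap[OF uV R B, folded x_def m_def, folded xc_def mc_def]
  have init: "x 0 = \<xi>" "m 0 = m0" by (simp_all add: x_def m_def u0 ap0)
  have meas: "x t \<in> borel_measurable M" "m t \<in> borel_measurable M" if "t \<in> {0..T}" for t
    using uV[OF that] by (auto simp: x_def m_def measurable_states_def)
  have fstd: "((\<lambda>t. fst (u t)) has_vector_derivative fst (field R B (u t))) (at t within {0..T})"
    and sndd: "((\<lambda>t. snd (u t)) has_vector_derivative snd (field R B (u t))) (at t within {0..T})"
    if "t \<in> {0..T}" for t
    using bounded_linear.has_vector_derivative[OF bounded_linear_fst du[OF that]]
      bounded_linear.has_vector_derivative[OF bounded_linear_snd du[OF that]] by auto
  have dx: "has_unif_deriv (principal UNIV) T x (H (xc t) (mc t)) t" if "t \<in> {0..T}" for t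
    using has_unif_deriv_component[OF fstd[OF that]] fa(3)[OF that] by (simp add: x_def[abs_def] xc_def[abs_def] mc_def[abs_def])
  have dm: "has_unif_deriv (principal UNIV) T m (\<lambda>s. mc t s * G (xc t) (mc t) s) t" if "t \<in> {0..T}" for t
    using has_unif_deriv_component[OF sndd[OF that]] fa(4)[OF that] by (simp add: m_def[abs_def] xc_def[abs_def] mc_def[abs_def])
  have dms: "((\<lambda>t. m t s) has_real_derivative mc t s * G (xc t) (mc t) s) (at t within {0..T})"
    if "t \<in> {0..T}" for t s
    using has_unif_deriv_pointwise[OF dm[OF that]] by simp
  have mcm: "\<bar>mc t s\<bar> \<le> \<bar>m t s\<bar>" "\<bar>mc t s\<bar> \<le> B" for t s
    using B by (auto simp: mc_def)
  have xcx: "\<bar>xc t s\<bar> \<le> \<bar>x t s\<bar>" "\<bar>xc t s\<bar> \<le> R" for t s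
    using R by (auto simp: xc_def)
  \<comment> \<open>Clipping does not increase absolute values, so the derivative of the unclipped
    \<open>m\<close> is still bounded by a multiple of \<open>m\<close> itself and
    \<open>sgn_preserved\<close> applies.\<close>
  have growth: "\<bar>mc t s * G (xc t) (mc t) s\<bar> \<le> b * \<bar>m t s\<bar>"
    if "\<bar>G (xc t) (mc t) s\<bar> \<le> b" for t s b
    using mult_mono[OF mcm(1)[of t s] that] by (simp add: abs_mult mult.commute)
  \<comment> \<open>The box-dependent bound on \<open>G\<close> suffices for the sign; the sharper
    rate \<open>k\<close> becomes available only after mass conservation.\<close>
  have pos: "0 < m t s" if t: "t \<in> {0..T}" for t s
  proof -
    have "sgn (m t s) = sgn (m 0 s)"
      by (rule sgn_preserved(1)[OF T t dms growth[OF fa(5)]])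
    then show ?thesis using m0_pos[of s] by (simp add: init sgn_if split: if_splits)
  qed
  have im: "integrable M (m t)" "integrable M (mc t)" if t: "t \<in> {0..T}" for t
    using integral_abs_le(2)[OF meas(2)[OF t], of "norm (snd (u t))"] abs_ap_le[of "snd (u t)"]
      integral_abs_le(2)[OF fa(2)[OF t], of B] mcm(2)[of t]
    by (auto simp: m_def mc_def[abs_def])
  have meas_c: "xc t \<in> borel_measurable M" "mc t \<in> borel_measurable M" if t: "t \<in> {0..T}" for t
    using fa(1,2)[OF t] by (simp_all add: xc_def[abs_def] mc_def[abs_def])
  \<comment> \<open>The mass of the unclipped \<open>m\<close> is conserved: its derivative is the
    integral of \<open>mc * G xc mc\<close>, which vanishes by antisymmetry.\<close>
  have "((\<lambda>t. \<integral>s. m t s \<partial>M) has_derivative (\<lambda>h. 0)) (at t within {0..T})" if t: "t \<in> {0..T}" for t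
  proof -
    have "integrable M (\<lambda>s. mc t s * G (xc t) (mc t) s)"
    proof (rule integral_abs_le(2))
      show "AE s in M. \<bar>mc t s * G (xc t) (mc t) s\<bar> \<le> B * (B * (2 * (B * (2 * l * R)) * q))"
        unfolding abs_mult using fa(5)[OF t] mcm(2)[of t] B by (intro AE_I2 mult_mono) auto
    qed (use meas_c[OF t] in measurable)
    then have "((\<lambda>t. \<integral>s. m t s \<partial>M) has_real_derivative (\<integral>s. mc t s * G (xc t) (mc t) s \<partial>M)) (at t within {0..T})"
      using im by (intro has_real_derivative_integral[OF dm] t) auto
    moreover have "(\<integral>s. mc t s * G (xc t) (mc t) s \<partial>M) = 0"
      using meas_c[OF t] mcm(2)[of t] xcx(2)[of t] R
      by (intro integral_mult_G_eq_0[of _ _ B R]) auto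
    ultimately show ?thesis by (simp add: has_field_derivative_def lambda_zero)
  qed
  then obtain c' where c': "\<And>t. t \<in> {0..T} \<Longrightarrow> (\<integral>s. m t s \<partial>M) = c'"
    using has_derivative_zero_constant[of "{0..T}" "\<lambda>t. \<integral>s. m t s \<partial>M"] by auto
  have mass_t: "(\<integral>s. m t s \<partial>M) = 1" if "t \<in> {0..T}" for t
    using c'[OF that] c'[of 0] T mass by (simp add: init)
  \<comment> \<open>Positivity turns conserved mass into a bound on the integral of the absolute
    value, the quantity used in \<open>abs_H_le\<close> and \<open>abs_G_le\<close>.\<close>
  have mc1: "(\<integral>s. \<bar>mc t s\<bar> \<partial>M) \<le> 1" if t: "t \<in> {0..T}" for t
  proof -
    have "(\<integral>s. \<bar>mc t s\<bar> \<partial>M) \<le> (\<integral>s. m t s \<partial>M)"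
      using im[OF t] mcm(1)[of t] pos[OF t] by (intro integral_mono) (auto simp: less_imp_le abs_of_pos)
    then show ?thesis by (simp add: mass_t[OF t])
  qed
  \<comment> \<open>The norm is not differentiable, hence the one-sided Gronwall lemma;
    \<open>mc1\<close> makes its rate \<open>2 * l\<close> free of \<open>B\<close>.\<close>
  have xnorm: "norm (fst (u t)) \<le> X * exp (2 * l * t)" if t: "t \<in> {0..T}" for t
  proof (rule dini_gronwall[OF t])
    show "norm (fst (u 0)) \<le> X"
      using X by (intro norm_bfun_le) (simp add: u0 ap0)
    show "continuous_on {0..T} (\<lambda>t. norm (fst (u t)))"
      by (intro continuous_on_norm continuous_on_fst contu)
    fix t e :: real assume t: "t \<in> {0..<T}" and e: "e > 0"
    then have t': "t \<in> {0..T}" by auto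
    have Hn: "norm (fst (field R B (u t))) \<le> 2 * l * norm (fst (u t))"
    proof (rule norm_bfun_le)
      fix s
      have xn: "\<bar>xc t s\<bar> \<le> norm (fst (u t))" for s
        using xcx(1)[of t s] abs_ap_le[of "fst (u t)" s] by (simp add: x_def)
      then have "\<bar>H (xc t) (mc t) s\<bar> \<le> (\<integral>s. \<bar>mc t s\<bar> \<partial>M) * (2 * l * norm (fst (u t)))"
        using im[OF t'] by (intro abs_H_le) auto
      also have "\<dots> \<le> 1 * (2 * l * norm (fst (u t)))"
        using mc1[OF t'] l by (intro mult_right_mono) auto
      finally show "\<bar>ap (fst (field R B (u t))) s\<bar> \<le> 2 * l * norm (fst (u t))"
        using fa(3)[OF t'] by (simp add: xc_def[abs_def] mc_def[abs_def])
    qed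
    obtain d where d: "d > 0" "\<And>r. r \<in> {0..T} \<Longrightarrow> norm (r - t) < d \<Longrightarrow>
        norm (fst (u r) - fst (u t) - (r - t) *\<^sub>R fst (field R B (u t))) \<le> e * norm (r - t)"
      using fstd[OF t'] e unfolding has_vector_derivative_def has_derivative_within_alt by metis
    have "norm (fst (u r)) \<le> norm (fst (u t)) + (r - t) * (2 * l * norm (fst (u t)) + e)"
      if r: "r \<in> {t<..T}" "r < t + d" for r
    proof -
      let ?v = "fst (field R B (u t))"
      have "norm (fst (u r)) \<le> norm (fst (u t) + (r - t) *\<^sub>R ?v) + norm (fst (u r) - fst (u t) - (r - t) *\<^sub>R ?v)"
        using norm_triangle_ineq[of "fst (u t) + (r - t) *\<^sub>R ?v" "fst (u r) - fst (u t) - (r - t) *\<^sub>R ?v"]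
        by (simp add: algebra_simps)
      also have "\<dots> \<le> (norm (fst (u t)) + (r - t) * norm ?v) + e * (r - t)"
        using d(2)[of r] r t norm_triangle_ineq[of "fst (u t)" "(r - t) *\<^sub>R ?v"]
        by (intro add_mono) auto
      also have "\<dots> \<le> (norm (fst (u t)) + (r - t) * (2 * l * norm (fst (u t)))) + e * (r - t)"
        using r Hn e by (intro add_mono mult_left_mono) auto
      finally show ?thesis by (simp add: algebra_simps)
    qed
    then show "\<exists>d>0. \<forall>r\<in>{t<..T}. r < t + d \<longrightarrow>
        norm (fst (u r)) \<le> norm (fst (u t)) + (r - t) * (2 * l * norm (fst (u t)) + e)"
      using d(1) by blast
  qed (use l X0 in auto)
  have xR: "\<bar>x t s\<bar> \<le> R" if t: "t \<in> {0..T}" for t s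
  proof -
    have "\<bar>x t s\<bar> \<le> X * exp (2 * l * t)"
      unfolding x_def using abs_ap_le xnorm[OF t] by (rule order_trans)
    also have "\<dots> \<le> R"
      unfolding R_def using t l X0 by (auto intro!: mult_left_mono)
    finally show ?thesis .
  qed
  have Gk: "\<bar>G (xc t) (mc t) s\<bar> \<le> k" if t: "t \<in> {0..T}" for t s
  proof -
    let ?I = "\<integral>s. \<bar>mc t s\<bar> \<partial>M"
    have "\<bar>G (xc t) (mc t) s\<bar> \<le> ?I * (2 * (?I * (2 * l * R)) * q)"
      using im[OF t] xcx(2)[of t] by (intro abs_G_le) auto
    also have "\<dots> \<le> 1 * (2 * (1 * (2 * l * R)) * q)"
      using mc1[OF t] l R q by (intro mult_mono mult_nonneg_nonneg) auto
    finally show ?thesis by (simp add: k_def)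
  qed
  have mtB: "\<bar>m t s\<bar> \<le> B" if t: "t \<in> {0..T}" for t s
  proof -
    have "\<bar>m t s\<bar> \<le> \<bar>m 0 s\<bar> * exp (k * t)"
      by (rule sgn_preserved(2)[OF T t dms growth[OF Gk]])
    also have "\<dots> \<le> m_max * exp (k * T)"
      using m0_pos[of s] m0_le[of s] t k by (intro mult_mono) (auto simp: init intro!: mult_left_mono)
    finally show ?thesis by (simp add: B_def)
  qed
  have xc: "xc t = x t" and mc: "mc t = m t" if "t \<in> {0..T}" for t
    using xR[OF that] mtB[OF that] by (auto simp: xc_def mc_def fun_eq_iff abs_le_iff max_def min_def) (smt (verit))+
  have fc: "ap (fst (field R B (u t))) = H (x t) (m t)"
      "ap (snd (field R B (u t))) = (\<lambda>s. m t s * G (x t) (m t) s)" if "t \<in> {0..T}" for t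
    using fa(3,4)[OF that] by (simp_all add: xc[OF that] mc[OF that])
  have cont_field: "continuous_on {0..T} (\<lambda>t. field R B (u t))"
    using uV by (intro continuous_on_compose2[OF lipschitz_on_continuous_on[OF lip] contu]) auto
  show thesis
  proof (rule that[of x m R B])
    fix t s assume t: "t \<in> {0..T}"
    show "\<bar>m t s * G (x t) (m t) s\<bar> \<le> B * (B * (2 * (B * (2 * l * R)) * q))"
      unfolding abs_mult by (intro mult_mono mtB[OF t] fa(5)[OF t, unfolded xc[OF t] mc[OF t]] B abs_ge_zero)
    show "has_unif_deriv (principal UNIV) T x (H (x t) (m t)) t"
      using dx[OF t] xc[OF t] mc[OF t] by simp
    show "has_unif_deriv (principal UNIV) T m (\<lambda>s. m t s * G (x t) (m t) s) t"
      using dm[OF t] xc[OF t] mc[OF t] by simp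
    fix e :: real assume e: "e > 0"
    show "\<exists>d>0. \<forall>r\<in>{0..T}. \<bar>r - t\<bar> < d \<longrightarrow> (\<forall>s. \<bar>H (x r) (m r) s - H (x t) (m t) s\<bar> \<le> e)"
      using unif_continuous_component[OF continuous_on_fst[OF cont_field] t e] fc(1)[OF t] fc(1)
      by (metis (no_types, lifting))
    show "\<exists>d>0. \<forall>r\<in>{0..T}. \<bar>r - t\<bar> < d \<longrightarrow>
        (\<forall>s. \<bar>m r s * G (x r) (m r) s - m t s * G (x t) (m t) s\<bar> \<le> e)"
      using unif_continuous_component[OF continuous_on_snd[OF cont_field] t e] fc(2)[OF t] fc(2)
      by (metis (no_types, lifting))
  qed (use init R B meas xR mtB in auto)
qed

section \<open>Preservation of order and reduction of the double integral\<close>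

text \<open>Two points of one state are compared here: the Lipschitz bound for \<open>a\<close>
  yields the differential inequality for differences of \<open>x\<close>, and later the continuity
  of \<open>H\<close> in \<open>s\<close>.\<close>

lemma abs_H_diff_same_le:
  assumes [measurable]: "x \<in> borel_measurable M" "m \<in> borel_measurable M"
    and m: "AE s in M. \<bar>m s\<bar> \<le> B" and x: "AE s in M. \<bar>x s\<bar> \<le> R" "\<bar>x s\<bar> \<le> R" "\<bar>x s'\<bar> \<le> R"
    and B: "0 \<le> B"
  shows "\<bar>H x m s - H x m s'\<bar> \<le> B * l * \<bar>x s - x s'\<bar>"
  unfolding H_def
proof (rule abs_integral_diff_le[where b = "B * (2 * l * R)" and b' = "B * (2 * l * R)"])
  show "AE s1 in M. \<bar>m s1 * a (x s1 - x s)\<bar> \<le> B * (2 * l * R)"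
    using m x(1) by eventually_elim (unfold abs_mult, intro mult_mono abs_a_le x B, auto)
  show "AE s1 in M. \<bar>m s1 * a (x s1 - x s')\<bar> \<le> B * (2 * l * R)"
    using m x(1) by eventually_elim (unfold abs_mult, intro mult_mono abs_a_le x B, auto)
  show "AE s1 in M. \<bar>m s1 * a (x s1 - x s) - m s1 * a (x s1 - x s')\<bar> \<le> B * l * \<bar>x s - x s'\<bar>"
    using m
  proof eventually_elim
    case (elim s1)
    have "\<bar>a (x s1 - x s) - a (x s1 - x s')\<bar> \<le> l * \<bar>x s - x s'\<bar>"
      using a_lip[of "x s1 - x s" "x s1 - x s'"] by (simp add: abs_minus_commute)
    then have "\<bar>m s1\<bar> * \<bar>a (x s1 - x s) - a (x s1 - x s')\<bar> \<le> B * (l * \<bar>x s - x s'\<bar>)"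
      using elim B by (intro mult_mono) auto
    then show ?case by (simp add: right_diff_distrib[symmetric] abs_mult mult.assoc)
  qed
qed measurable

text \<open>\<open>H\<close> does not involve the kernel, so this holds for any solution of the
  equation for \<open>x\<close>, with the order of \<open>x 0\<close> and not of
  \<open>\<xi>\<close>. The sign statement undoes the freezing; the spread estimate yields
  continuity in \<open>s\<close>.\<close>

lemma order_preserved:
  assumes t: "t \<in> {0..T}" and s: "s \<in> space M" "s' \<in> space M" and B: "0 \<le> B"
    and meas: "\<And>t. t \<in> {0..T} \<Longrightarrow> x t \<in> borel_measurable M" "\<And>t. t \<in> {0..T} \<Longrightarrow> m t \<in> borel_measurable M"
    and xR: "\<And>t s. t \<in> {0..T} \<Longrightarrow> s \<in> space M \<Longrightarrow> \<bar>x t s\<bar> \<le> R"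
    and mB: "\<And>t. t \<in> {0..T} \<Longrightarrow> AE s in M. \<bar>m t s\<bar> \<le> B"
    and der: "\<And>t. t \<in> {0..T} \<Longrightarrow> has_unif_deriv (principal (space M)) T x (H (x t) (m t)) t"
  shows "sgn (x t s - x t s') = sgn (x 0 s - x 0 s')"
    and "\<bar>x t s - x t s'\<bar> \<le> \<bar>x 0 s - x 0 s'\<bar> * exp (B * l * t)"
proof -
  have T: "0 \<le> T" using t by simp
  have d: "((\<lambda>t. x t s - x t s') has_real_derivative H (x t) (m t) s - H (x t) (m t) s') (at t within {0..T})"
    if "t \<in> {0..T}" for t
    using has_unif_deriv_pointwise[OF der[OF that]] s by (intro DERIV_diff) auto
  have b: "\<bar>H (x t) (m t) s - H (x t) (m t) s'\<bar> \<le> B * l * \<bar>x t s - x t s'\<bar>" if "t \<in> {0..T}" for t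
    using meas[OF that] xR[OF that] mB[OF that] s B by (intro abs_H_diff_same_le[where R = R]) auto
  show "sgn (x t s - x t s') = sgn (x 0 s - x 0 s')"
    by (rule sgn_preserved(1)[OF T t d b])
  show "\<bar>x t s - x t s'\<bar> \<le> \<bar>x 0 s - x 0 s'\<bar> * exp (B * l * t)"
    by (rule sgn_preserved(2)[OF T t d b])
qed

text \<open>Fubini, after checking integrability on the product: the kernel does not depend on the
  second variable, so the inner integral splits into two values of \<open>H\<close>.\<close>

lemma double_integral_eq_G:
  assumes [measurable]: "x \<in> borel_measurable M" "m \<in> borel_measurable M"
    and m: "AE s in M. \<bar>m s\<bar> \<le> B" and x: "AE s in M. \<bar>x s\<bar> \<le> R" "\<bar>x s\<bar> \<le> R"
  shows "(\<integral>(s1, s2). m s1 * m s2 * (a (x s2 - x s) + a (x s2 - x s1)) * ker x s s1 \<partial>(M \<Otimes>\<^sub>M M)) = G x m s"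
proof -
  interpret P: pair_prob_space M M ..
  define f where "f s1 s2 = m s1 * m s2 * (a (x s2 - x s) + a (x s2 - x s1)) * ker x s s1" for s1 s2
  have [measurable]: "(\<lambda>(s1, s2). f s1 s2) \<in> borel_measurable (M \<Otimes>\<^sub>M M)"
    unfolding f_def by measurable
  have mx: "AE s in M. \<bar>m s\<bar> \<le> B \<and> \<bar>x s\<bar> \<le> R" using m x(1) by eventually_elim auto
  have fb: "\<bar>f s1 s2\<bar> \<le> B * B * (2 * (2 * l * R)) * q"
    if "\<bar>m s1\<bar> \<le> B" "\<bar>m s2\<bar> \<le> B" "\<bar>x s1\<bar> \<le> R" "\<bar>x s2\<bar> \<le> R" for s1 s2
  proof -
    have "\<bar>a (x s2 - x s) + a (x s2 - x s1)\<bar> \<le> 2 * (2 * l * R)"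
      using abs_a_le[OF that(4) x(2)] abs_a_le[OF that(4) that(3)] by linarith
    moreover have "\<bar>ker x s s1\<bar> \<le> q" unfolding ker_def by (rule kernel_bound)
    moreover have "0 \<le> B" "0 \<le> R" using that by linarith+
    ultimately show ?thesis
      using that l unfolding f_def abs_mult by (intro mult_mono) auto
  qed
  have "AE s1 in M. AE s2 in M. \<bar>f s1 s2\<bar> \<le> B * B * (2 * (2 * l * R)) * q"
    using mx
  proof eventually_elim
    case (elim s1)
    show ?case using mx by eventually_elim (rule fb, use elim in auto)
  qed
  then have "AE p in M \<Otimes>\<^sub>M M. norm (case p of (s1, s2) \<Rightarrow> f s1 s2) \<le> B * B * (2 * (2 * l * R)) * q"
    by (intro P.AE_pair_measure) (auto simp: split_beta')
  then have int: "integrable (M \<Otimes>\<^sub>M M) (\<lambda>(s1, s2). f s1 s2)"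
    by (intro P.P.integrable_const_bound) auto
  have inth: "integrable M (\<lambda>s2. m s2 * a (x s2 - x s1))" if "\<bar>x s1\<bar> \<le> R" for s1
  proof (rule integral_abs_le(2))
    show "AE s2 in M. \<bar>m s2 * a (x s2 - x s1)\<bar> \<le> B * (2 * l * R)"
      using mx by eventually_elim
        (unfold abs_mult, intro mult_mono abs_a_le that, auto intro: order_trans[OF abs_ge_zero])
  qed measurable
  have "(\<integral>(s1, s2). f s1 s2 \<partial>(M \<Otimes>\<^sub>M M)) = (\<integral>s1. (\<integral>s2. f s1 s2 \<partial>M) \<partial>M)"
    using P.integral_fst[OF int] by simp
  also have "\<dots> = (\<integral>s1. m s1 * (H x m s + H x m s1) * ker x s s1 \<partial>M)"
  proof (rule integral_cong_AE)
    show "AE s1 in M. (\<integral>s2. f s1 s2 \<partial>M) = m s1 * (H x m s + H x m s1) * ker x s s1"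
      using x(1)
    proof eventually_elim
      case (elim s1)
      have "(\<integral>s2. f s1 s2 \<partial>M) =
          (\<integral>s2. m s1 * ker x s s1 * (m s2 * a (x s2 - x s) + m s2 * a (x s2 - x s1)) \<partial>M)"
        by (simp add: f_def algebra_simps)
      also have "\<dots> = m s1 * ker x s s1 * (H x m s + H x m s1)"
        using inth[OF x(2)] inth[OF elim] by (simp add: H_def)
      finally show ?case by (simp add: mult_ac)
    qed
  qed measurable
  finally show ?thesis by (simp add: f_def G_def)
qed

text \<open>The common form for constructed and given solutions: \<open>x\<close> is controlled at
  every point and \<open>m\<close> almost everywhere, as in the two norms. The box \<open>R\<close>,
  \<open>B\<close> supplies the Lipschitz constants.\<close>

definition bounded_solution ::
  "real \<Rightarrow> real \<Rightarrow> real \<Rightarrow> (real \<Rightarrow> 'a \<Rightarrow> real) \<Rightarrow> (real \<Rightarrow> 'a \<Rightarrow> real) \<Rightarrow> bool" where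
  "bounded_solution T R B x m \<longleftrightarrow> (\<forall>t\<in>{0..T}.
    x t \<in> borel_measurable M \<and> m t \<in> borel_measurable M \<and>
    (\<forall>s\<in>space M. \<bar>x t s\<bar> \<le> R) \<and> (AE s in M. \<bar>m t s\<bar> \<le> B) \<and>
    has_unif_deriv (principal (space M)) T x (H (x t) (m t)) t \<and>
    has_unif_deriv (ae_filter M) T m (\<lambda>s. m t s * G (x t) (m t) s) t)"

lemma bounded_solution_mono:
  assumes "bounded_solution T R B x m" "R \<le> R'" "B \<le> B'"
  shows "bounded_solution T R' B' x m"
proof -
  have "AE s in M. \<bar>m t s\<bar> \<le> B'" if "AE s in M. \<bar>m t s\<bar> \<le> B" for t
    using that by eventually_elim (use assms(3) in linarith)
  then show ?thesis
    using assms unfolding bounded_solution_def by (meson order_trans)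
qed

theorem bounded_solution_unique:
  assumes sx: "bounded_solution T R B x m" and sy: "bounded_solution T R B y n"
    and R: "0 \<le> R" and B: "0 \<le> B" and t: "t \<in> {0..T}"
    and init: "\<And>s. s \<in> space M \<Longrightarrow> x 0 s = y 0 s" "AE s in M. m 0 s = n 0 s"
  shows "s \<in> space M \<Longrightarrow> x t s = y t s" "AE s in M. m t s = n t s"
proof -
  define p where "p t s = x t s - y t s" for t s
  define w where "w t s = m t s - n t s" for t s
  \<comment> \<open>The distance is the larger of the sup norm of \<open>p\<close> and the essential
    sup norm of \<open>w\<close>, encoded by its upper bounds so that both are treated through
    filters.\<close>
  define P where "P t c \<longleftrightarrow> 0 \<le> c \<and> (\<forall>\<^sub>F s in principal (space M). \<bar>p t s\<bar> \<le> c) \<and> (AE s in M. \<bar>w t s\<bar> \<le> c)"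
    for t c
  define vp where "vp t s = H (x t) (m t) s - H (y t) (n t) s" for t s
  define vw where "vw t s = m t s * G (x t) (m t) s - n t s * G (y t) (n t) s" for t s
  have q: "0 \<le> q" using kernel_bound[of undefined undefined 0] by linarith
  \<comment> \<open>The same constants as for the clipped field; the box now plays the part of the
    clipping.\<close>
  define K1 where "K1 = 2 * l * (R + B)"
  define Kg where "Kg = B * (2 * (B * (2 * l * R)) * q)"
  define K2 where "K2 = 4 * B * l * R * q + B * (4 * l * (R + B)) * q + B * (4 * B * l * R) * (2 * S)"
  define K where "K = K1 + (Kg + B * K2)"
  have K0: "0 \<le> K1" "0 \<le> Kg" "0 \<le> K2"
    using l R B q S by (auto simp: K1_def K2_def Kg_def)
  then have K: "0 \<le> K" using B by (simp add: K_def)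
  have sol: "x t \<in> borel_measurable M" "m t \<in> borel_measurable M" "y t \<in> borel_measurable M" "n t \<in> borel_measurable M"
      "s \<in> space M \<Longrightarrow> \<bar>x t s\<bar> \<le> R" "s \<in> space M \<Longrightarrow> \<bar>y t s\<bar> \<le> R"
      "AE s in M. \<bar>x t s\<bar> \<le> R" "AE s in M. \<bar>y t s\<bar> \<le> R"
      "AE s in M. \<bar>m t s\<bar> \<le> B" "AE s in M. \<bar>n t s\<bar> \<le> B"
    if "t \<in> {0..T}" for t s
    using sx sy that unfolding bounded_solution_def by auto
  have dp: "has_unif_deriv (principal (space M)) T p (vp t) t" and dw: "has_unif_deriv (ae_filter M) T w (vw t) t"
    if "t \<in> {0..T}" for t
    using sx sy that unfolding bounded_solution_def p_def[abs_def] w_def[abs_def] vp_def[abs_def] vw_def[abs_def]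
    by (auto intro: has_unif_deriv_diff)
  have vbound: "(\<forall>\<^sub>F s in principal (space M). \<bar>vp t s\<bar> \<le> K * c) \<and> (AE s in M. \<bar>vw t s\<bar> \<le> K * c)"
    if P: "P t c" and t: "t \<in> {0..T}" for t c
  proof -
    have c: "0 \<le> c" and pc: "s \<in> space M \<Longrightarrow> \<bar>x t s - y t s\<bar> \<le> c" and wc: "AE s in M. \<bar>m t s - n t s\<bar> \<le> c" for s
      using P by (auto simp: P_def p_def w_def eventually_principal)
    note S = sol[OF t]
    have pc': "AE s in M. \<bar>x t s - y t s\<bar> \<le> c" using pc by auto
    have "\<bar>vp t s\<bar> \<le> K * c" if s: "s \<in> space M" for s
    proof -
      have "\<bar>vp t s\<bar> \<le> c * K1"
        unfolding vp_def K1_def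
        by (rule abs_H_diff_le[OF S(1-4) S(9,10) wc S(7,8) pc' S(5)[OF s] S(6)[OF s] pc[OF s] B R])
      also have "\<dots> \<le> K * c"
        using mult_left_mono[of K1 K c] c K0 B by (simp add: K_def mult.commute)
      finally show ?thesis .
    qed
    moreover have "AE s in M. \<bar>vw t s\<bar> \<le> K * c"
      using AE_space S(9,10) wc
    proof eventually_elim
      case (elim s)
      have Gd: "\<bar>G (x t) (m t) s - G (y t) (n t) s\<bar> \<le> c * K2"
        unfolding K2_def
        by (rule abs_G_diff_le[OF S(1-4) S(9,10) wc S(7,8) pc' S(5)[OF elim(1)] S(6)[OF elim(1)] pc[OF elim(1)] B R])
      have Gb: "\<bar>G (x t) (m t) s\<bar> \<le> Kg" "\<bar>G (y t) (n t) s\<bar> \<le> Kg"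
        unfolding Kg_def
        by (rule abs_H_G_le_const(2)[OF S(2) S(9) S(7) S(5)[OF elim(1)] B]
            abs_H_G_le_const(2)[OF S(4) S(10) S(8) S(6)[OF elim(1)] B])+
      have "\<bar>m t s * G (x t) (m t) s * 1 - n t s * G (y t) (n t) s * 1\<bar> \<le> c * Kg * 1 + B * (c * K2) * 1 + B * Kg * 0"
        by (rule abs_mult3_diff_le[OF Gb(1) _ elim(3) Gb(2) elim(4) Gd]) simp_all
      then have "\<bar>vw t s\<bar> \<le> (Kg + B * K2) * c" by (simp add: vw_def algebra_simps)
      also have "\<dots> \<le> K * c" using c K0 by (intro mult_right_mono) (auto simp: K_def)
      finally show ?case .
    qed
    ultimately show ?thesis by (simp add: eventually_principal)
  qed
  \<comment> \<open>A crude bound from the box: it makes the set of bounds nonempty and, through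
    \<open>vbound\<close>, bounds the derivatives for the continuity step.\<close>
  have ex: "P t (2 * R + 2 * B)" if t: "t \<in> {0..T}" for t
  proof -
    have "\<bar>p t s\<bar> \<le> 2 * R + 2 * B" if "s \<in> space M" for s
      using sol(5,6)[OF t that] B by (simp add: p_def)
    moreover have "AE s in M. \<bar>w t s\<bar> \<le> 2 * R + 2 * B"
      using sol(9,10)[OF t] by eventually_elim (use R in \<open>simp add: w_def\<close>)
    ultimately show ?thesis using R B by (auto simp: P_def eventually_principal)
  qed
  have Pc: "P t c" if c: "c > 0" for c
  proof (rule dini_gronwall_bounds[where P = P, OF t K c])
    fix t c c' assume "P t c" "c \<le> c'"
    then show "P t c'" unfolding P_def by (auto elim!: eventually_mono)
  next
    fix t c assume "P t c" then show "0 \<le> c" by (simp add: P_def)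
  next
    fix t assume "t \<in> {0..T}" then show "\<exists>c. P t c" using ex by blast
  next
    show "P 0 0"
      using init by (auto simp: P_def p_def w_def eventually_principal)
  next
    fix t e :: real assume t: "t \<in> {0..T}" and e: "e > 0"
    obtain d1 where d1: "d1 > 0" "\<And>r. r \<in> {0..T} \<Longrightarrow> \<bar>r - t\<bar> < d1 \<Longrightarrow>
        \<forall>\<^sub>F s in principal (space M). \<bar>p r s - p t s\<bar> \<le> e"
      using has_unif_deriv_continuous[OF dp[OF t] _ e] vbound[OF ex[OF t] t] by blast
    obtain d2 where d2: "d2 > 0" "\<And>r. r \<in> {0..T} \<Longrightarrow> \<bar>r - t\<bar> < d2 \<Longrightarrow> AE s in M. \<bar>w r s - w t s\<bar> \<le> e"
      using has_unif_deriv_continuous[OF dw[OF t] _ e] vbound[OF ex[OF t] t] by blast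
    have "(P t c \<longrightarrow> P r (c + e)) \<and> (P r c \<longrightarrow> P t (c + e))"
      if r: "r \<in> {0..T}" "\<bar>r - t\<bar> < min d1 d2" for r c
    proof -
      have ev: "\<forall>\<^sub>F s in principal (space M). \<bar>p r s - p t s\<bar> \<le> e" "AE s in M. \<bar>w r s - w t s\<bar> \<le> e"
        using r d1 d2 by auto
      have ev': "\<forall>\<^sub>F s in principal (space M). \<bar>p t s - p r s\<bar> \<le> e" "AE s in M. \<bar>w t s - w r s\<bar> \<le> e"
        using ev by (simp_all add: abs_minus_commute)
      have tri: "\<forall>\<^sub>F s in F. \<bar>f' s\<bar> \<le> c + e"
        if "\<forall>\<^sub>F s in F. \<bar>f s\<bar> \<le> c" "\<forall>\<^sub>F s in F. \<bar>f' s - f s\<bar> \<le> e"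
        for f f' :: "'a \<Rightarrow> real" and F
        using that by eventually_elim linarith
      show ?thesis
        using tri[OF _ ev(1)] tri[OF _ ev(2)] tri[OF _ ev'(1)] tri[OF _ ev'(2)] e
        unfolding P_def by (meson add_nonneg_nonneg less_imp_le)
    qed
    then show "\<exists>d>0. \<forall>r\<in>{0..T}. \<bar>r - t\<bar> < d \<longrightarrow> (\<forall>c. (P t c \<longrightarrow> P r (c + e)) \<and> (P r c \<longrightarrow> P t (c + e)))"
      using d1(1) d2(1) by (intro exI[of _ "min d1 d2"]) auto
  next
    fix t e :: real assume t0: "t \<in> {0..<T}" and e: "e > 0"
    then have t: "t \<in> {0..T}" by auto
    obtain d1 where d1: "d1 > 0" "\<And>r c k. r \<in> {t<..T} \<Longrightarrow> r < t + d1 \<Longrightarrow>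
        \<forall>\<^sub>F s in principal (space M). \<bar>p t s\<bar> \<le> c \<Longrightarrow> \<forall>\<^sub>F s in principal (space M). \<bar>vp t s\<bar> \<le> k \<Longrightarrow>
        \<forall>\<^sub>F s in principal (space M). \<bar>p r s\<bar> \<le> c + (r - t) * (k + e)"
      using has_unif_deriv_step[OF dp[OF t] t e] by blast
    obtain d2 where d2: "d2 > 0" "\<And>r c k. r \<in> {t<..T} \<Longrightarrow> r < t + d2 \<Longrightarrow>
        AE s in M. \<bar>w t s\<bar> \<le> c \<Longrightarrow> AE s in M. \<bar>vw t s\<bar> \<le> k \<Longrightarrow>
        AE s in M. \<bar>w r s\<bar> \<le> c + (r - t) * (k + e)"
      using has_unif_deriv_step[OF dw[OF t] t e] by blast
    have "P r (c + (r - t) * (K * c + e))" if r: "r \<in> {t<..T}" "r < t + min d1 d2" and P: "P t c" for r c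
      using d1(2)[of r c "K * c"] d2(2)[of r c "K * c"] r P vbound[OF P t] K e
      unfolding P_def by auto
    then show "\<exists>d>0. \<forall>r\<in>{t<..T}. r < t + d \<longrightarrow> (\<forall>c. P t c \<longrightarrow> P r (c + (r - t) * (K * c + e)))"
      using d1(1) d2(1) by (intro exI[of _ "min d1 d2"]) auto
  qed
  show "x t s = y t s" if "s \<in> space M"
  proof -
    have "\<bar>p t s\<bar> \<le> c" if "c > 0" for c
      using Pc[OF that] \<open>s \<in> space M\<close> by (simp add: P_def eventually_principal)
    then have "\<bar>p t s\<bar> \<le> 0" by (rule field_le_epsilon[of _ 0, simplified])
    then show ?thesis by (simp add: p_def)
  qed
  \<comment> \<open>The null set depends on the bound \<open>c\<close>; the countably many bounds
    \<open>inverse (real (Suc k))\<close> allow a single null set.\<close>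
  have w0: "m t s = n t s" if "\<And>k. \<bar>w t s\<bar> \<le> inverse (real (Suc k))" for s
  proof (rule ccontr)
    assume "m t s \<noteq> n t s"
    then have "0 < \<bar>w t s\<bar>" by (simp add: w_def)
    then obtain k where "inverse (real (Suc k)) < \<bar>w t s\<bar>" using reals_Archimedean by blast
    then show False using that[of k] by linarith
  qed
  have "AE s in M. \<bar>w t s\<bar> \<le> inverse (real (Suc k))" for k
    using Pc[of "inverse (real (Suc k))"] unfolding P_def by simp
  then have "AE s in M. \<forall>k. \<bar>w t s\<bar> \<le> inverse (real (Suc k))"
    unfolding AE_all_countable by (rule allI)
  then show "AE s in M. m t s = n t s"
    by (rule eventually_mono) (use w0 in blast)
qed

end

subsection \<open>The system on the unit interval\<close>

text \<open>\<open>\<sigma>\<close> is Lipschitz on each half line, so it has one-sided limits at 0,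
  opposite by oddness. Subtracting the jump leaves a function that is continuous at 0 and Lipschitz
  with the same constant.\<close>

lemma odd_jump_decomposition:
  fixes \<sigma> :: "real \<Rightarrow> real"
  assumes odd: "\<And>z. \<sigma> (- z) = - \<sigma> z" and S: "0 < S"
    and lip: "\<And>z w. 0 < z \<Longrightarrow> 0 < w \<Longrightarrow> \<bar>\<sigma> z - \<sigma> w\<bar> \<le> S * \<bar>z - w\<bar>"
  obtains c \<rho> where "\<And>z. \<sigma> z = c * sgn z + \<rho> z" "\<And>z. \<rho> (- z) = - \<rho> z"
    "\<And>z w. \<bar>\<rho> z - \<rho> w\<bar> \<le> S * \<bar>z - w\<bar>"
proof -
  \<comment> \<open>the one-sided limit of \<open>\<sigma>\<close> at \<open>0\<close>\<close>
  define c where "c = (INF z\<in>{0<..}. \<sigma> z + S * z)"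
  \<comment> \<open>Every value \<open>\<sigma> z - S * z\<close> lies below every value
    \<open>\<sigma> w + S * w\<close>; the infimum \<open>c\<close> of the latter separates them,
    which gives the estimate at 0 without taking a limit.\<close>
  have lower: "\<sigma> z - S * z \<le> \<sigma> w + S * w" if "0 < z" "0 < w" for z w
  proof -
    have "S * \<bar>z - w\<bar> \<le> S * (z + w)"
      using that S by (intro mult_left_mono) auto
    then show ?thesis
      using lip[OF that] by (simp add: algebra_simps)
  qed
  have jump: "\<bar>\<sigma> z - c\<bar> \<le> S * z" if z: "0 < z" for z
  proof -
    have "c \<le> \<sigma> z + S * z"
      unfolding c_def using z lower[of 1]
      by (intro cINF_lower bdd_belowI[of _ "\<sigma> 1 - S * 1"]) auto
    moreover have "\<sigma> z - S * z \<le> c"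
      unfolding c_def using lower[OF z] by (intro cINF_greatest) (auto intro: exI[of _ 1])
    ultimately show ?thesis by linarith
  qed
  define \<rho> where "\<rho> z = \<sigma> z - c * sgn z" for z
  have \<rho>_odd: "\<rho> (- z) = - \<rho> z" for z by (simp add: \<rho>_def odd)
  have \<rho>0: "\<rho> 0 = 0" using odd[of 0] by (simp add: \<rho>_def)
  have \<rho>_pos: "\<bar>\<rho> z\<bar> \<le> S * z" if "0 < z" for z using jump[OF that] that by (simp add: \<rho>_def)
  have \<rho>_abs: "\<bar>\<rho> z\<bar> \<le> S * \<bar>z\<bar>" for z
    using \<rho>_pos[of z] \<rho>_pos[of "- z"] \<rho>0 by (cases z "0 :: real" rule: linorder_cases) (auto simp: \<rho>_odd)
  have \<rho>_lip: "\<bar>\<rho> z - \<rho> w\<bar> \<le> S * \<bar>z - w\<bar>" for z w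
  proof -
    \<comment> \<open>The last case covers opposite signs and zeros: the segment passes through 0,
      so the bounds by \<open>S * \<bar>z\<bar>\<close> and \<open>S * \<bar>w\<bar>\<close> add up
      exactly.\<close>
    consider "0 < z \<and> 0 < w" | "z < 0 \<and> w < 0" | "\<bar>z - w\<bar> = \<bar>z\<bar> + \<bar>w\<bar>" by linarith
    then show ?thesis
    proof cases
      case 1
      then show ?thesis using lip[of z w] by (simp add: \<rho>_def)
    next
      case 2
      then have "\<bar>\<sigma> (- z) - \<sigma> (- w)\<bar> \<le> S * \<bar>(- z) - (- w)\<bar>" by (intro lip) auto
      then show ?thesis using 2 by (simp add: \<rho>_def odd abs_minus_commute)
    next
      case 3
      have "\<bar>\<rho> z - \<rho> w\<bar> \<le> S * \<bar>z\<bar> + S * \<bar>w\<bar>"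
        using \<rho>_abs[of z] \<rho>_abs[of w] by linarith
      then show ?thesis by (simp add: 3 algebra_simps)
    qed
  qed
  show thesis
    by (rule that[of c \<rho>]) (simp_all add: \<rho>_odd \<rho>_lip, simp add: \<rho>_def)
qed

section \<open>The norms of C(I) and L^infinity(I) in terms of pointwise and almost everywhere
  bounds\<close>

lemma prob_space_leb_I: "prob_space leb_I"
  by (rule prob_spaceI) (simp add: emeasure_restrict_space)

lemma C_norm_nonneg: "0 \<le> C_norm f"
  unfolding C_norm_def by (rule SUP_upper2[of 0]) auto

lemma C_norm_le_iff: "C_norm f \<le> ereal e \<longleftrightarrow> (\<forall>s\<in>I01. \<bar>f s\<bar> \<le> e)"
  by (simp add: C_norm_def SUP_le_iff)

lemma Linf_norm_nonneg: "0 \<le> Linf_norm f"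
proof -
  have "emeasure leb_I (space leb_I) \<noteq> 0"
    using prob_space.emeasure_space_1[OF prob_space_leb_I] by simp
  then have "0 = esssup leb_I (\<lambda>s. 0 :: ereal)" by (simp add: esssup_const)
  also have "\<dots> \<le> Linf_norm f"
    unfolding Linf_norm_def by (intro esssup_mono) auto
  finally show ?thesis .
qed

lemma Linf_norm_leD: "Linf_norm f \<le> ereal e \<Longrightarrow> AE s in leb_I. \<bar>f s\<bar> \<le> e"
proof -
  assume le: "Linf_norm f \<le> ereal e"
  have "AE s in leb_I. ereal \<bar>f s\<bar> \<le> Linf_norm f"
    unfolding Linf_norm_def by (rule esssup_AE)
  then show ?thesis
  proof (rule eventually_mono)
    fix s assume "ereal \<bar>f s\<bar> \<le> Linf_norm f"
    then have "ereal \<bar>f s\<bar> \<le> ereal e" using le by (rule order_trans)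
    then show "\<bar>f s\<bar> \<le> e" by simp
  qed
qed

lemma Linf_norm_leI: "f \<in> borel_measurable leb_I \<Longrightarrow> AE s in leb_I. \<bar>f s\<bar> \<le> e \<Longrightarrow> Linf_norm f \<le> ereal e"
  unfolding Linf_norm_def by (rule esssup_I) auto

lemma Linf_I_iff: "f \<in> Linf_I \<longleftrightarrow> f \<in> borel_measurable leb_I \<and> (\<exists>b. AE s in leb_I. \<bar>f s\<bar> \<le> b)"
proof
  assume f: "f \<in> Linf_I"
  then have "Linf_norm f = ereal (real_of_ereal (Linf_norm f))"
    using Linf_norm_nonneg[of f] by (cases "Linf_norm f") (auto simp: Linf_I_def)
  then have "AE s in leb_I. \<bar>f s\<bar> \<le> real_of_ereal (Linf_norm f)"
    by (intro Linf_norm_leD) simp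
  then show "f \<in> borel_measurable leb_I \<and> (\<exists>b. AE s in leb_I. \<bar>f s\<bar> \<le> b)"
    using f by (auto simp: Linf_I_def)
next
  assume "f \<in> borel_measurable leb_I \<and> (\<exists>b. AE s in leb_I. \<bar>f s\<bar> \<le> b)"
  then obtain b where "f \<in> borel_measurable leb_I" "Linf_norm f \<le> ereal b"
    using Linf_norm_leI by blast
  then show "f \<in> Linf_I" by (auto simp: Linf_I_def)
qed

lemma C_I_bounded: "f \<in> C_I \<Longrightarrow> \<exists>b. \<forall>s\<in>I01. \<bar>f s\<bar> \<le> b"
  using compact_imp_bounded[OF compact_continuous_image[of I01 f]]
  by (auto simp: C_I_def bounded_iff)

lemma C_I_measurable: "f \<in> C_I \<Longrightarrow> f \<in> borel_measurable leb_I"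
  by (simp add: C_I_def continuous_imp_measurable_on_sets_lebesgue)

lemma tendsto_ereal_0_iff:
  fixes N :: "'b \<Rightarrow> ereal"
  assumes "\<And>r. 0 \<le> N r"
  shows "(N \<longlongrightarrow> 0) F \<longleftrightarrow> (\<forall>e>0. \<forall>\<^sub>F r in F. N r \<le> ereal e)"
proof
  assume lim: "(N \<longlongrightarrow> 0) F"
  show "\<forall>e>0. \<forall>\<^sub>F r in F. N r \<le> ereal e"
  proof (intro allI impI)
    fix e :: real assume "e > 0"
    then have "\<forall>\<^sub>F r in F. N r < ereal e" using order_tendstoD(2)[OF lim, of "ereal e"] by simp
    then show "\<forall>\<^sub>F r in F. N r \<le> ereal e" by (rule eventually_mono) simp
  qed
next
  assume *: "\<forall>e>0. \<forall>\<^sub>F r in F. N r \<le> ereal e"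
  show "(N \<longlongrightarrow> 0) F"
  proof (rule order_tendstoI)
    fix y :: ereal assume "y < 0"
    then show "\<forall>\<^sub>F r in F. y < N r" using assms by (intro always_eventually allI) (rule less_le_trans)
  next
    fix y :: ereal assume "0 < y"
    then obtain e where e: "0 < ereal e" "ereal e < y" using ereal_dense2 by blast
    then have "\<forall>\<^sub>F r in F. N r \<le> ereal e" using * by simp
    then show "\<forall>\<^sub>F r in F. N r < y" by (rule eventually_mono) (use e in auto)
  qed
qed

lemma has_time_deriv_C_norm_iff:
  "has_time_deriv C_norm T u v t \<longleftrightarrow> has_unif_deriv (principal I01) T u v t"
  unfolding has_time_deriv_def tendsto_ereal_0_iff[OF C_norm_nonneg] C_norm_le_iff
    has_unif_deriv_iff_quotient eventually_principal ..

lemma has_time_deriv_Linf_normD: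
  assumes "has_time_deriv Linf_norm T u v t"
  shows "has_unif_deriv (ae_filter leb_I) T u v t"
  unfolding has_unif_deriv_iff_quotient
proof (intro allI impI)
  fix e :: real assume "e > 0"
  then have "\<forall>\<^sub>F r in at t within {0..T}. Linf_norm (\<lambda>s. (u r s - u t s) / (r - t) - v s) \<le> ereal e"
    using assms unfolding has_time_deriv_def tendsto_ereal_0_iff[OF Linf_norm_nonneg] by blast
  then show "\<forall>\<^sub>F r in at t within {0..T}. AE s in leb_I. \<bar>(u r s - u t s) / (r - t) - v s\<bar> \<le> e"
    by (rule eventually_mono) (rule Linf_norm_leD)
qed

lemma has_time_deriv_Linf_normI:
  assumes der: "has_unif_deriv (ae_filter leb_I) T u v t" and t: "t \<in> {0..T}"
    and u: "\<And>r. r \<in> {0..T} \<Longrightarrow> u r \<in> borel_measurable leb_I" and v: "v \<in> borel_measurable leb_I"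
  shows "has_time_deriv Linf_norm T u v t"
  unfolding has_time_deriv_def tendsto_ereal_0_iff[OF Linf_norm_nonneg]
proof (intro allI impI)
  fix e :: real assume "e > 0"
  then have ev: "\<forall>\<^sub>F r in at t within {0..T}. AE s in leb_I. \<bar>(u r s - u t s) / (r - t) - v s\<bar> \<le> e"
    using der unfolding has_unif_deriv_iff_quotient by blast
  \<comment> \<open>Measurability of \<open>u r\<close> is known only for times in the interval, and
    without it the essential supremum would be infinite.\<close>
  have "\<forall>\<^sub>F r in at t within {0..T}. r \<in> {0..T}" by (simp add: eventually_at_filter)
  then show "\<forall>\<^sub>F r in at t within {0..T}. Linf_norm (\<lambda>s. (u r s - u t s) / (r - t) - v s) \<le> ereal e"
    using ev
  proof (rule eventually_elim2)
    fix r assume r: "r \<in> {0..T}" and ae: "AE s in leb_I. \<bar>(u r s - u t s) / (r - t) - v s\<bar> \<le> e"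
    have [measurable]: "u r \<in> borel_measurable leb_I" "u t \<in> borel_measurable leb_I" "v \<in> borel_measurable leb_I"
      using u r t v by auto
    have "(\<lambda>s. (u r s - u t s) / (r - t) - v s) \<in> borel_measurable leb_I" by measurable
    then show "Linf_norm (\<lambda>s. (u r s - u t s) / (r - t) - v s) \<le> ereal e"
      using ae by (rule Linf_norm_leI)
  qed
qed

lemma continuous_curveI:
  assumes N: "\<And>f. 0 \<le> N f"
    and cont: "\<And>t e. t \<in> {0..T} \<Longrightarrow> e > 0 \<Longrightarrow>
      \<exists>d>0. \<forall>r\<in>{0..T}. \<bar>r - t\<bar> < d \<longrightarrow> N (\<lambda>s. v r s - v t s) \<le> ereal e"
  shows "continuous_curve N T v"
  unfolding continuous_curve_def tendsto_ereal_0_iff[OF N] eventually_at dist_real_def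
  using cont by meson

locale opinion_system = opinion_dynamics leb_I a \<rho> \<xi> c l S q
  for a \<rho> \<xi> :: "real \<Rightarrow> real" and c l S q :: real +
  fixes \<sigma> :: "real \<Rightarrow> real"
  assumes \<sigma>: "\<sigma> z = c * sgn z + \<rho> z"
begin

lemma Psi_eq:
  assumes x: "x \<in> borel_measurable leb_I" "\<And>s. s \<in> I01 \<Longrightarrow> \<bar>x s\<bar> \<le> R"
    and m: "m \<in> borel_measurable leb_I" "AE s in leb_I. \<bar>m s\<bar> \<le> B"
    and s: "s \<in> I01" and ord: "\<And>s1. s1 \<in> I01 \<Longrightarrow> sgn (x s - x s1) = sgn (\<xi> s - \<xi> s1)"
  shows "Psi a \<sigma> s x m = m s * G x m s"
proof -
  have "AE s in leb_I. \<bar>x s\<bar> \<le> R" using x(2) by (intro AE_I2) simp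
  note eq = double_integral_eq_G[OF x(1) m this x(2)[OF s]]
  have "(\<integral>(s1, s2). m s1 * m s2 * (a (x s2 - x s) + a (x s2 - x s1)) * \<sigma> (x s - x s1) \<partial>(leb_I \<Otimes>\<^sub>M leb_I))
      = (\<integral>(s1, s2). m s1 * m s2 * (a (x s2 - x s) + a (x s2 - x s1)) * ker x s s1 \<partial>(leb_I \<Otimes>\<^sub>M leb_I))"
    by (rule Bochner_Integration.integral_cong[OF refl])
      (auto simp: space_pair_measure \<sigma> ker_def ord)
  then show ?thesis unfolding Psi_def eq by simp
qed

lemma solution_bounded:
  assumes sol: "solves_system a \<sigma> x0 m0 T y n" and T: "0 \<le> T" and x0: "\<And>s. s \<in> I01 \<Longrightarrow> x0 s = \<xi> s"
  obtains R B where "0 \<le> R" "0 \<le> B" "bounded_solution T R B y n"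
proof -
  have yC: "y t \<in> C_I" and nL: "n t \<in> Linf_I" if "t \<in> {0..T}" for t
    using sol that by (auto simp: solves_system_def C1_curves_def)
  \<comment> \<open>These derivatives lie in the two spaces by definition of the curves and are thus
    bounded, which gives the box before anything is known about \<open>H\<close> or
    \<open>Psi\<close>.\<close>
  obtain vy vn where v: "\<And>t. t \<in> {0..T} \<Longrightarrow> vy t \<in> C_I" "\<And>t. t \<in> {0..T} \<Longrightarrow> vn t \<in> Linf_I"
    "\<And>t. t \<in> {0..T} \<Longrightarrow> has_time_deriv C_norm T y (vy t) t"
    "\<And>t. t \<in> {0..T} \<Longrightarrow> has_time_deriv Linf_norm T n (vn t) t"
    using sol unfolding solves_system_def C1_curves_def by blast
  have "\<exists>v b. has_unif_deriv (principal I01) T y v t \<and> (\<forall>\<^sub>F s in principal I01. \<bar>v s\<bar> \<le> b)"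
      "\<exists>b. \<forall>\<^sub>F s in principal I01. \<bar>y t s\<bar> \<le> b" if t: "t \<in> {0..T}" for t
    using v(3)[OF t] C_I_bounded[OF v(1)[OF t]] C_I_bounded[OF yC[OF t]]
    unfolding has_time_deriv_C_norm_iff eventually_principal by blast+
  then obtain R where R: "0 \<le> R" "\<And>t. t \<in> {0..T} \<Longrightarrow> \<forall>\<^sub>F s in principal I01. \<bar>y t s\<bar> \<le> R"
    using uniformly_bounded_curve[OF T, of "principal I01" y] by blast
  have "\<exists>v b. has_unif_deriv (ae_filter leb_I) T n v t \<and> (AE s in leb_I. \<bar>v s\<bar> \<le> b)"
      "\<exists>b. AE s in leb_I. \<bar>n t s\<bar> \<le> b" if t: "t \<in> {0..T}" for t
    using has_time_deriv_Linf_normD[OF v(4)[OF t]] v(2)[OF t] nL[OF t] unfolding Linf_I_iff by blast+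
  then obtain B where B: "0 \<le> B" "\<And>t. t \<in> {0..T} \<Longrightarrow> AE s in leb_I. \<bar>n t s\<bar> \<le> B"
    using uniformly_bounded_curve[OF T, of "ae_filter leb_I" n] by blast
  have meas: "y t \<in> borel_measurable leb_I" "n t \<in> borel_measurable leb_I" if "t \<in> {0..T}" for t
    using yC[OF that] nL[OF that] by (auto simp: C_I_measurable Linf_I_iff)
  have yR: "\<bar>y t s\<bar> \<le> R" if "t \<in> {0..T}" "s \<in> I01" for t s
    using R(2)[OF that(1)] that(2) by (simp add: eventually_principal)
  have dy: "has_unif_deriv (principal (space leb_I)) T y (H (y t) (n t)) t" if "t \<in> {0..T}" for t
    using sol that unfolding solves_system_def has_time_deriv_C_norm_iff H_def[abs_def] by simp
  have ord: "sgn (y t s - y t s1) = sgn (\<xi> s - \<xi> s1)" if "t \<in> {0..T}" "s \<in> I01" "s1 \<in> I01" for t s s1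
  proof -
    have "sgn (y t s - y t s1) = sgn (y 0 s - y 0 s1)"
      using that yR by (intro order_preserved(1)[OF that(1) _ _ B(1) meas _ B(2) dy]) auto
    then show ?thesis using sol that x0 by (simp add: solves_system_def)
  qed
  have "has_unif_deriv (ae_filter leb_I) T n (\<lambda>s. n t s * G (y t) (n t) s) t" if t: "t \<in> {0..T}" for t
  proof (rule has_unif_deriv_cong[OF has_time_deriv_Linf_normD])
    show "has_time_deriv Linf_norm T n (\<lambda>s. Psi a \<sigma> s (y t) (n t)) t"
      using sol t by (simp add: solves_system_def)
    show "AE s in leb_I. Psi a \<sigma> s (y t) (n t) = n t s * G (y t) (n t) s"
      using Psi_eq[OF meas(1)[OF t] yR[OF t] meas(2)[OF t] B(2)[OF t] _ ord[OF t]] by (intro AE_I2) simp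
  qed
  then have "bounded_solution T R B y n"
    using meas yR B(2) dy unfolding bounded_solution_def by simp
  then show thesis using that R(1) B(1) by blast
qed

lemma solves_system_exists:
  assumes T: "0 \<le> T" and m0: "m0 \<in> borel_measurable leb_I" and m0_pos: "\<And>s. 0 < m0 s"
    and m0_le: "\<And>s. m0 s \<le> m_max" and mass: "(\<integral>s. m0 s \<partial>leb_I) = 1"
    and X: "\<And>s. \<bar>\<xi> s\<bar> \<le> X" and \<xi>C: "\<xi> \<in> C_I"
  obtains x m where "solves_system a \<sigma> \<xi> m0 T x m"
proof -
  obtain x m R B where init: "x 0 = \<xi>" "m 0 = m0" and R: "0 \<le> R" and B: "0 \<le> B"
    and meas: "\<And>t. t \<in> {0..T} \<Longrightarrow> x t \<in> borel_measurable leb_I"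
    "\<And>t. t \<in> {0..T} \<Longrightarrow> m t \<in> borel_measurable leb_I"
    and xR: "\<And>t s. t \<in> {0..T} \<Longrightarrow> \<bar>x t s\<bar> \<le> R"
    and mB: "\<And>t s. t \<in> {0..T} \<Longrightarrow> \<bar>m t s\<bar> \<le> B"
    and mG: "\<And>t s. t \<in> {0..T} \<Longrightarrow> \<bar>m t s * G (x t) (m t) s\<bar> \<le> B * (B * (2 * (B * (2 * l * R)) * q))"
    and dx: "\<And>t. t \<in> {0..T} \<Longrightarrow> has_unif_deriv (principal UNIV) T x (H (x t) (m t)) t"
    and dm: "\<And>t. t \<in> {0..T} \<Longrightarrow> has_unif_deriv (principal UNIV) T m (\<lambda>s. m t s * G (x t) (m t) s) t"
    and cx: "\<And>t e. t \<in> {0..T} \<Longrightarrow> e > 0 \<Longrightarrow> \<exists>d>0. \<forall>r\<in>{0..T}. \<bar>r - t\<bar> < d \<longrightarrow>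
        (\<forall>s. \<bar>H (x r) (m r) s - H (x t) (m t) s\<bar> \<le> e)"
    and cm: "\<And>t e. t \<in> {0..T} \<Longrightarrow> e > 0 \<Longrightarrow> \<exists>d>0. \<forall>r\<in>{0..T}. \<bar>r - t\<bar> < d \<longrightarrow>
        (\<forall>s. \<bar>m r s * G (x r) (m r) s - m t s * G (x t) (m t) s\<bar> \<le> e)"
    using solution_exists[OF T m0 m0_pos m0_le mass X] by blast
  have dxI: "has_unif_deriv (principal I01) T x (H (x t) (m t)) t" if "t \<in> {0..T}" for t
    using dx[OF that] by (rule has_unif_deriv_mono) simp
  have dxS: "has_unif_deriv (principal (space leb_I)) T x (H (x t) (m t)) t" if "t \<in> {0..T}" for t
    using dxI[OF that] by simp
  have mB': "AE s in leb_I. \<bar>m t s\<bar> \<le> B" if "t \<in> {0..T}" for t using mB[OF that] by simp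
  have xR': "AE s in leb_I. \<bar>x t s\<bar> \<le> R" if "t \<in> {0..T}" for t using xR[OF that] by simp
  have ord: "sgn (x t s - x t s1) = sgn (\<xi> s - \<xi> s1)"
    and spread: "\<bar>x t s - x t s1\<bar> \<le> \<bar>\<xi> s - \<xi> s1\<bar> * exp (B * l * t)"
    if "t \<in> {0..T}" "s \<in> I01" "s1 \<in> I01" for t s s1
    using order_preserved[where x = x and m = m and s = s and s' = s1, OF that(1) _ _ B meas xR mB' dxS] that(2,3)
    by (simp_all add: init)
  have Psi: "Psi a \<sigma> s (x t) (m t) = m t s * G (x t) (m t) s" if "t \<in> {0..T}" "s \<in> I01" for t s
    using Psi_eq[OF meas(1)[OF that(1)] xR[OF that(1)] meas(2)[OF that(1)] mB'[OF that(1)] that(2) ord[OF that]]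
    by simp
  \<comment> \<open>Continuity in \<open>s\<close> is not built into the space of bounded functions;
    it is inherited from \<open>\<xi>\<close> by any function whose differences are dominated by
    those of \<open>\<xi>\<close>.\<close>
  have lip_cont: "f \<in> C_I" if "\<And>s s1. s \<in> I01 \<Longrightarrow> s1 \<in> I01 \<Longrightarrow> \<bar>f s - f s1\<bar> \<le> k * \<bar>\<xi> s - \<xi> s1\<bar>"
    for f :: "real \<Rightarrow> real" and k
    unfolding C_I_def continuous_on_def mem_Collect_eq
  proof
    fix s assume s: "s \<in> I01"
    have "(\<xi> \<longlongrightarrow> \<xi> s) (at s within I01)" using \<xi>C s by (simp add: C_I_def continuous_on_def)
    then have "((\<lambda>s1. k * \<bar>\<xi> s1 - \<xi> s\<bar>) \<longlongrightarrow> k * \<bar>\<xi> s - \<xi> s\<bar>) (at s within I01)"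
      by (intro tendsto_intros)
    then have lim: "((\<lambda>s1. k * \<bar>\<xi> s1 - \<xi> s\<bar>) \<longlongrightarrow> 0) (at s within I01)" by simp
    have "\<forall>\<^sub>F s1 in at s within I01. norm (f s1 - f s) \<le> k * \<bar>\<xi> s1 - \<xi> s\<bar>"
      using that s by (auto simp: eventually_at_filter)
    then have "((\<lambda>s1. f s1 - f s) \<longlongrightarrow> 0) (at s within I01)"
      using lim by (rule Lim_null_comparison)
    then show "(f \<longlongrightarrow> f s) (at s within I01)" by (simp add: LIM_zero_iff)
  qed
  have xC: "x t \<in> C_I" if "t \<in> {0..T}" for t
    using spread[OF that] by (intro lip_cont[of _ "exp (B * l * t)"]) (simp add: mult.commute)
  have HC: "H (x t) (m t) \<in> C_I" if t: "t \<in> {0..T}" for t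
  proof (rule lip_cont)
    fix s s1 assume s: "s \<in> I01" "s1 \<in> I01"
    have "\<bar>H (x t) (m t) s - H (x t) (m t) s1\<bar> \<le> B * l * \<bar>x t s - x t s1\<bar>"
      by (rule abs_H_diff_same_le[OF meas(1)[OF t] meas(2)[OF t] mB'[OF t] xR'[OF t] xR[OF t] xR[OF t] B])
    also have "\<dots> \<le> B * l * (\<bar>\<xi> s - \<xi> s1\<bar> * exp (B * l * t))"
      using spread[OF t s] B l by (intro mult_left_mono) auto
    finally show "\<bar>H (x t) (m t) s - H (x t) (m t) s1\<bar> \<le> (B * l * exp (B * l * t)) * \<bar>\<xi> s - \<xi> s1\<bar>"
      by (simp add: mult_ac)
  qed
  have mGm: "(\<lambda>s. m t s * G (x t) (m t) s) \<in> borel_measurable leb_I" if t: "t \<in> {0..T}" for t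
    using meas(2)[OF t] measurable_G[OF meas(1)[OF t] meas(2)[OF t]] by (rule borel_measurable_times)
  have mGL: "(\<lambda>s. m t s * G (x t) (m t) s) \<in> Linf_I" if t: "t \<in> {0..T}" for t
    using mGm[OF t] mG[OF t] unfolding Linf_I_iff by blast
  have mL: "m t \<in> Linf_I" if t: "t \<in> {0..T}" for t
    using meas(2)[OF t] mB'[OF t] unfolding Linf_I_iff by blast
  have dm': "has_time_deriv Linf_norm T m (\<lambda>s. m t s * G (x t) (m t) s) t" if t: "t \<in> {0..T}" for t
    by (rule has_time_deriv_Linf_normI[OF has_unif_deriv_mono[OF dm[OF t]] t meas(2) mGm[OF t]]) auto
  have Psi_ae: "AE s in leb_I. m t s * G (x t) (m t) s = Psi a \<sigma> s (x t) (m t)" if t: "t \<in> {0..T}" for t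
    using Psi[OF t] by (intro AE_I2) simp
  have Psi_meas: "(\<lambda>s. Psi a \<sigma> s (x t) (m t)) \<in> borel_measurable leb_I" if t: "t \<in> {0..T}" for t
    \<comment> \<open>Outside the unit interval the two functions may differ, but measurability on
      \<open>leb_I\<close> sees only points of the interval.\<close>
    using mGm[OF t] by (rule measurable_cong[THEN iffD1, rotated]) (simp add: Psi[OF t])
  have dPsi: "has_time_deriv Linf_norm T m (\<lambda>s. Psi a \<sigma> s (x t) (m t)) t" if t: "t \<in> {0..T}" for t
    by (rule has_time_deriv_Linf_normI[OF has_unif_deriv_cong[OF has_time_deriv_Linf_normD[OF dm'[OF t]] Psi_ae[OF t]]
        t meas(2) Psi_meas[OF t]])
  have "continuous_curve C_norm T (\<lambda>t. H (x t) (m t))"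
    using cx by (intro continuous_curveI C_norm_nonneg) (unfold C_norm_le_iff, meson)
  then have 1: "x \<in> C1_curves C_I C_norm T"
    unfolding C1_curves_def
    by (intro CollectI conjI ballI exI[of _ "\<lambda>t. H (x t) (m t)"] xC HC)
      (simp_all add: has_time_deriv_C_norm_iff dxI)
  \<comment> \<open>The derivative curve is taken as \<open>m * G\<close> and not as
    \<open>Psi\<close>: its continuity in time comes from the vector field.\<close>
  have "continuous_curve Linf_norm T (\<lambda>t s. m t s * G (x t) (m t) s)"
  proof (intro continuous_curveI Linf_norm_nonneg)
    fix t e :: real assume t: "t \<in> {0..T}" and e: "e > 0"
    obtain d where d: "d > 0" "\<And>r s. r \<in> {0..T} \<Longrightarrow> \<bar>r - t\<bar> < d \<Longrightarrow>
        \<bar>m r s * G (x r) (m r) s - m t s * G (x t) (m t) s\<bar> \<le> e"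
      using cm[OF t e] by blast
    have "Linf_norm (\<lambda>s. m r s * G (x r) (m r) s - m t s * G (x t) (m t) s) \<le> ereal e"
      if r: "r \<in> {0..T}" "\<bar>r - t\<bar> < d" for r
      by (rule Linf_norm_leI[OF borel_measurable_diff[OF mGm[OF r(1)] mGm[OF t]]]) (use d(2)[OF r] in simp)
    then show "\<exists>d>0. \<forall>r\<in>{0..T}. \<bar>r - t\<bar> < d \<longrightarrow>
        Linf_norm (\<lambda>s. m r s * G (x r) (m r) s - m t s * G (x t) (m t) s) \<le> ereal e"
      using d(1) by blast
  qed
  then have 2: "m \<in> C1_curves Linf_I Linf_norm T"
    unfolding C1_curves_def
    by (intro CollectI conjI ballI exI[of _ "\<lambda>t s. m t s * G (x t) (m t) s"] mL mGL dm') simp_all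
  have "solves_system a \<sigma> \<xi> m0 T x m"
    unfolding solves_system_def has_time_deriv_C_norm_iff
    using 1 2 dPsi dxI init by (simp add: H_def[abs_def])
  then show thesis by (rule that)
qed

end

theorem theorem3p1:
  fixes a \<sigma> x0 m0 :: "real \<Rightarrow> real" and T L M X Sinf S :: real
  assumes "T > 0"
    and H1: "\<exists>C. C-lipschitz_on UNIV a" "Lip a = L" "a 0 = 0"
    and H2_m: "m0 \<in> Linf_I" "(\<integral>s. m0 s \<partial>leb_I) = 1"
      "M > 1" "AE s in leb_I. 1 / M \<le> m0 s \<and> m0 s \<le> M"
    and H2_x: "x0 \<in> C_I" "inj_on x0 I01" "X > 0" "\<forall>s\<in>I01. \<bar>x0 s\<bar> \<le> X"
    and H3: "\<forall>z. \<sigma> (- z) = - \<sigma> z"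
      "Sinf > 0" "\<forall>z. \<bar>\<sigma> z\<bar> \<le> Sinf"
      "S > 0" "\<forall>z1\<in>{0<..}. \<forall>z2\<in>{0<..}. \<bar>\<sigma> z1 - \<sigma> z2\<bar> \<le> S * \<bar>z1 - z2\<bar>"
      "\<forall>z1\<in>{..<0}. \<forall>z2\<in>{..<0}. \<bar>\<sigma> z1 - \<sigma> z2\<bar> \<le> S * \<bar>z1 - z2\<bar>"
  shows "\<exists>x m. solves_system a \<sigma> x0 m0 T x m \<and>
    (\<forall>y n. solves_system a \<sigma> x0 m0 T y n \<longrightarrow>
      (\<forall>t\<in>{0..T}. (\<forall>s\<in>I01. y t s = x t s) \<and> (AE s in leb_I. n t s = m t s)))"
proof -
  have T: "0 \<le> T" using \<open>T > 0\<close> by simp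
  obtain C where C: "C-lipschitz_on UNIV a" using H1(1) by blast
  have a_lip: "\<bar>a z - a w\<bar> \<le> C * \<bar>z - w\<bar>" for z w
    using lipschitz_onD[OF C, of z w] by (simp add: dist_real_def)
  have lip: "\<bar>\<sigma> z - \<sigma> w\<bar> \<le> S * \<bar>z - w\<bar>" if "0 < z" "0 < w" for z w
    using H3(5) that by auto
  from H3(1) have odd: "\<sigma> (- z) = - \<sigma> z" for z by blast
  obtain c \<rho> where \<sigma>: "\<And>z. \<sigma> z = c * sgn z + \<rho> z" and \<rho>_odd: "\<And>z. \<rho> (- z) = - \<rho> z"
    and \<rho>_lip: "\<And>z w. \<bar>\<rho> z - \<rho> w\<bar> \<le> S * \<bar>z - w\<bar>"
    by (rule odd_jump_decomposition[of \<sigma> S, OF odd H3(4) lip]) blast+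
  \<comment> \<open>The abstract existence theorem needs bounds at every real point, while the data
    satisfy them only on the interval or almost everywhere. Clipping selects representatives with
    bounds everywhere.\<close>
  define \<xi> where "\<xi> s = clip X (x0 s)" for s
  define \<mu> where "\<mu> s = max (1 / M) (min M (m0 s))" for s
  have \<xi>_x0: "x0 s = \<xi> s" if "s \<in> I01" for s
    using H2_x(4) that by (force simp: \<xi>_def abs_le_iff)
  have \<xi>C: "\<xi> \<in> C_I"
    using H2_x(1) unfolding C_I_def mem_Collect_eq \<xi>_def by (intro continuous_intros)
  have \<xi>X: "\<bar>\<xi> s\<bar> \<le> X" for s using H2_x(3) by (auto simp: \<xi>_def)
  have [measurable]: "m0 \<in> borel_measurable leb_I" using H2_m(1) by (simp add: Linf_I_def)
  have \<mu>_meas: "\<mu> \<in> borel_measurable leb_I" unfolding \<mu>_def by measurable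
  have \<mu>_m0: "AE s in leb_I. \<mu> s = m0 s"
    using H2_m(4) by eventually_elim (auto simp: \<mu>_def)
  have mass: "(\<integral>s. \<mu> s \<partial>leb_I) = 1"
    using integral_cong_AE[OF \<mu>_meas _ \<mu>_m0] H2_m(2) by simp
  have \<mu>_pos: "0 < \<mu> s" for s using H2_m(3) by (auto simp: \<mu>_def less_max_iff_disj)
  have \<mu>_le: "\<mu> s \<le> M" for s
  proof -
    have "1 / M \<le> 1" using H2_m(3) by simp
    then show ?thesis using H2_m(3) unfolding \<mu>_def by linarith
  qed
  have bound: "\<bar>c * sgn (\<xi> s - \<xi> s') + \<rho> z\<bar> \<le> 2 * \<bar>c\<bar> + Sinf" for s s' z
  proof -
    have sgn_le: "\<bar>c * sgn w\<bar> \<le> \<bar>c\<bar>" for w :: real by (simp add: abs_mult sgn_if)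
    have "\<bar>\<sigma> z\<bar> \<le> Sinf" using H3(3) by blast
    then show ?thesis using \<sigma>[of z] sgn_le[of z] sgn_le[of "\<xi> s - \<xi> s'"] by linarith
  qed
  interpret prob_space leb_I by (rule prob_space_leb_I)
  interpret opinion_system a \<rho> \<xi> c C S "2 * \<bar>c\<bar> + Sinf" \<sigma>
    by unfold_locales
      (use a_lip H1(3) lipschitz_on_nonneg[OF C] \<rho>_lip \<rho>_odd H3(4) C_I_measurable[OF \<xi>C] bound \<sigma> in auto)
  obtain x m where "solves_system a \<sigma> \<xi> \<mu> T x m"
    using solves_system_exists[OF T \<mu>_meas \<mu>_pos \<mu>_le mass \<xi>X \<xi>C] .
  then have "solves_system a \<sigma> \<xi> m0 T x m"
    unfolding solves_system_def using \<mu>_m0 by (auto elim: eventually_elim2)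
  then have sol: "solves_system a \<sigma> x0 m0 T x m"
    by (simp add: solves_system_def \<xi>_x0)
  obtain R B where RB: "0 \<le> R" "0 \<le> B" "bounded_solution T R B x m"
    using solution_bounded[OF sol T \<xi>_x0] .
  have "(\<forall>s\<in>I01. y t s = x t s) \<and> (AE s in leb_I. n t s = m t s)"
    if sol': "solves_system a \<sigma> x0 m0 T y n" and t: "t \<in> {0..T}" for y n t
  proof -
    obtain R' B' where RB': "0 \<le> R'" "0 \<le> B'" "bounded_solution T R' B' y n"
      using solution_bounded[OF sol' T \<xi>_x0] .
    have init: "y 0 s = x 0 s" if "s \<in> space leb_I" for s
      using sol sol' that by (simp add: solves_system_def)
    have "AE s in leb_I. n 0 s = m0 s" "AE s in leb_I. m 0 s = m0 s"
      using sol sol' by (simp_all add: solves_system_def)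
    then have init': "AE s in leb_I. n 0 s = m 0 s" by eventually_elim simp
    \<comment> \<open>The comparison uses one Lipschitz constant, so both solutions are placed in a
      common box.\<close>
    have b: "bounded_solution T (max R R') (max B B') y n" "bounded_solution T (max R R') (max B B') x m"
      using bounded_solution_mono[OF RB'(3)] bounded_solution_mono[OF RB(3)] by simp_all
    show ?thesis
      using bounded_solution_unique[OF b _ _ t init init'] RB(1,2) by auto
  qed
  with sol show ?thesis by blast
qed

end
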